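(* Let $\Gamma$ be a connected signed graph of order $n\geq 2$. Then $$i_-(\Gamma)\geq \frac{n-p(\Gamma)}{2}-\theta(\Gamma).$$ Moreover, $$i_-(\Gamma)\geq \frac{n-p(\Gamma)+1}{2}-\theta(\Gamma)$$ if either $p(\Gamma)\geq 1$, or $p(\Gamma)=0$ and there are two distinct cycles of $\Gamma$ that have common vertices.
   Context: All graphs are finite and simple. A signed graph $\Gamma=(G,\sigma)$ consists of a simple graph $G=(V(G),E(G))$ (the underlying graph) and a sign function $\sigma:E(G)\to\{+,-\}$. Its order is $n=|V(G)|$. Graph-theoretic notions for $\Gamma$ (connectedness, degree, cycles, components) refer to $G$. The adjacency matrix $A(\Gamma)$ is the real symmetric matrix indexed by $V(G)$ whose $(u,v)$ entry is $+1$ if $uv\in E(G)$ and $\sigma(uv)=+$, $-1$ if $uv\in E(G)$ and $\sigma(uv)=-$, and $0$ if $uv\notin E(G)$. The negative inertia index $i_-(\Gamma)$ is the number of negative eigenvalues of $A(\Gamma)$, counted with multiplicity. The cyclomatic number is $\theta(\Gamma)=|E(G)|-|V(G)|+c(G)$, where $c(G)$ is the number of connected components of $G$. A pendant vertex is a vertex of degree $1$, and $p(\Gamma)$ denotes the number of pendant vertices of $\Gamma$. *)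

theory Defs
  imports "Jordan_Normal_Form.Char_Poly"
begin

datatype sign = Plus | Minus

record 'a signed_graph =
  verts :: "'a set"
  edges :: "'a set set"
  sgn_of :: "'a set \<Rightarrow> sign"  \<comment> \<open>only the values on \<open>edges\<close> matter\<close>

definition signed_graph :: "'a signed_graph \<Rightarrow> bool" where
  "signed_graph \<Gamma> \<longleftrightarrow> finite (verts \<Gamma>) \<and> (\<forall>e \<in> edges \<Gamma>. e \<subseteq> verts \<Gamma> \<and> card e = 2)"

definition graph_order :: "'a signed_graph \<Rightarrow> nat" where
  "graph_order \<Gamma> = card (verts \<Gamma>)"

definition reachable :: "'a signed_graph \<Rightarrow> ('a \<times> 'a) set" where
  "reachable \<Gamma> = {(u, v) \<in> verts \<Gamma> \<times> verts \<Gamma>. (u, v) \<in> {(x, y). {x, y} \<in> edges \<Gamma>}\<^sup>*}"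

definition components :: "'a signed_graph \<Rightarrow> 'a set set" where
  "components \<Gamma> = verts \<Gamma> // reachable \<Gamma>"

definition connected_graph :: "'a signed_graph \<Rightarrow> bool" where
  "connected_graph \<Gamma> \<longleftrightarrow> verts \<Gamma> \<noteq> {} \<and> (\<forall>u \<in> verts \<Gamma>. \<forall>v \<in> verts \<Gamma>. (u, v) \<in> reachable \<Gamma>)"

definition cyclomatic :: "'a signed_graph \<Rightarrow> int" where
  "cyclomatic \<Gamma> = int (card (edges \<Gamma>)) - int (card (verts \<Gamma>)) + int (card (components \<Gamma>))"

definition vertex_degree :: "'a signed_graph \<Rightarrow> 'a \<Rightarrow> nat" where
  "vertex_degree \<Gamma> v = card {e \<in> edges \<Gamma>. v \<in> e}"

definition num_pendant :: "'a signed_graph \<Rightarrow> nat" where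
  "num_pendant \<Gamma> = card {v \<in> verts \<Gamma>. vertex_degree \<Gamma> v = 1}"

text \<open>A cycle is presented by a list of its vertices in cyclic order. Different lists
  (rotations, reversals) present the same cycle; as a subgraph the cycle is determined by its
  edge set, so two cycles are distinct iff their edge sets differ.\<close>

definition cycle_edges :: "'a list \<Rightarrow> 'a set set" where
  "cycle_edges c = {{c ! i, c ! (Suc i mod length c)} | i. i < length c}"

definition is_cycle :: "'a signed_graph \<Rightarrow> 'a list \<Rightarrow> bool" where
  "is_cycle \<Gamma> c \<longleftrightarrow> length c \<ge> 3 \<and> distinct c \<and> cycle_edges c \<subseteq> edges \<Gamma>"

definition adj_entry :: "'a signed_graph \<Rightarrow> 'a \<Rightarrow> 'a \<Rightarrow> real" where
  "adj_entry \<Gamma> u v =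
     (if {u, v} \<in> edges \<Gamma> then (case sgn_of \<Gamma> {u, v} of Plus \<Rightarrow> 1 | Minus \<Rightarrow> - 1) else 0)"

text \<open>Library matrices are indexed by numbers, so the adjacency matrix is taken with respect to an
  enumeration of the vertices. The choice does not affect the characteristic polynomial; see
  \<open>char_poly_adj_mat_enum\<close> below.\<close>

definition adj_mat_enum :: "'a signed_graph \<Rightarrow> 'a list \<Rightarrow> real mat" where
  "adj_mat_enum \<Gamma> vs =
     mat (length vs) (length vs) (\<lambda>(i, j). adj_entry \<Gamma> (vs ! i) (vs ! j))"

definition adj_mat :: "'a signed_graph \<Rightarrow> real mat" where
  "adj_mat \<Gamma> = adj_mat_enum \<Gamma> (SOME vs. distinct vs \<and> set vs = verts \<Gamma>)"

definition neg_inertia :: "'a signed_graph \<Rightarrow> nat" where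
  "neg_inertia \<Gamma> =
     (\<Sum>x \<in> {x. eigenvalue (adj_mat \<Gamma>) x \<and> x < 0}. order x (char_poly (adj_mat \<Gamma>)))"

lemma similar_adj_mat_enum:
  assumes "distinct vs" "distinct ws" "set vs = set ws"
  shows "similar_mat (adj_mat_enum \<Gamma> vs) (adj_mat_enum \<Gamma> ws)"
proof -
  define n where "n = length vs"
  have lw: "length ws = n"
    using assms n_def by (metis distinct_card)
  define P :: "real mat" where "P = mat n n (\<lambda>(i, j). if vs ! i = ws ! j then 1 else 0)"
  define Q :: "real mat" where "Q = mat n n (\<lambda>(i, j). if ws ! i = vs ! j then 1 else 0)"
  define A where "A = adj_mat_enum \<Gamma> vs"
  define B where "B = adj_mat_enum \<Gamma> ws"
  have carr: "A \<in> carrier_mat n n" "B \<in> carrier_mat n n" "P \<in> carrier_mat n n" "Q \<in> carrier_mat n n"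
    unfolding A_def B_def P_def Q_def adj_mat_enum_def using lw by (auto simp: n_def)
  have delta: "(\<Sum>k = 0..<n. (if x = us ! k then 1 else 0) * f (us ! k)) = f x"
    if "distinct us" "length us = n" "x \<in> set us" for us :: "'a list" and x and f :: "'a \<Rightarrow> real"
  proof -
    from that obtain i where i: "i < n" "x = us ! i" by (metis in_set_conv_nth)
    have "(\<Sum>k = 0..<n. (if x = us ! k then 1 else 0) * f (us ! k))
        = (\<Sum>k = 0..<n. if k = i then f x else 0)"
      by (rule sum.cong) (use that i in \<open>auto simp: nth_eq_iff_index_eq\<close>)
    then show ?thesis using i by simp
  qed
  have mem: "vs ! i \<in> set ws" "ws ! i \<in> set vs" "vs ! i \<in> set vs" "ws ! i \<in> set ws" if "i < n" for i
    using that assms lw n_def nth_mem by metis+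
  have PQ: "P * Q = 1\<^sub>m n"
  proof (rule eq_matI)
    fix i j assume "i < dim_row (1\<^sub>m n :: real mat)" "j < dim_col (1\<^sub>m n :: real mat)"
    then have ij: "i < n" "j < n" by auto
    have "(P * Q) $$ (i, j)
        = (\<Sum>k = 0..<n. (if vs ! i = ws ! k then 1 else 0) * (if ws ! k = vs ! j then 1 else 0))"
      using ij by (simp add: P_def Q_def scalar_prod_def)
    also have "\<dots> = (if vs ! i = vs ! j then 1 else 0)"
      using delta[OF assms(2) lw mem(1)[OF ij(1)], of "\<lambda>x. if x = vs ! j then 1 else 0"] by simp
    finally show "(P * Q) $$ (i, j) = 1\<^sub>m n $$ (i, j)"
      using ij assms(1) by (simp add: nth_eq_iff_index_eq n_def)
  qed (use carr in auto)
  have QP: "Q * P = 1\<^sub>m n"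
    using mat_mult_left_right_inverse[OF carr(3,4) PQ] .
  have PB: "P * B = mat n n (\<lambda>(i, j). adj_entry \<Gamma> (vs ! i) (ws ! j))"
  proof (rule eq_matI)
    fix i j assume "i < dim_row (mat n n (\<lambda>(i, j). adj_entry \<Gamma> (vs ! i) (ws ! j)))"
      "j < dim_col (mat n n (\<lambda>(i, j). adj_entry \<Gamma> (vs ! i) (ws ! j)))"
    then have ij: "i < n" "j < n" by auto
    have "(P * B) $$ (i, j)
        = (\<Sum>k = 0..<n. (if vs ! i = ws ! k then 1 else 0) * adj_entry \<Gamma> (ws ! k) (ws ! j))"
      using ij lw by (simp add: P_def B_def adj_mat_enum_def scalar_prod_def)
    also have "\<dots> = adj_entry \<Gamma> (vs ! i) (ws ! j)"
      using delta[OF assms(2) lw mem(1)[OF ij(1)], of "\<lambda>x. adj_entry \<Gamma> x (ws ! j)"] by simp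
    finally show "(P * B) $$ (i, j) = mat n n (\<lambda>(i, j). adj_entry \<Gamma> (vs ! i) (ws ! j)) $$ (i, j)"
      using ij by simp
  qed (use carr in auto)
  have "A = P * B * Q"
  proof (rule eq_matI)
    fix i j assume "i < dim_row (P * B * Q)" "j < dim_col (P * B * Q)"
    then have ij: "i < n" "j < n" using carr by auto
    have "(P * B * Q) $$ (i, j)
        = (\<Sum>k = 0..<n. adj_entry \<Gamma> (vs ! i) (ws ! k) * (if ws ! k = vs ! j then 1 else 0))"
      unfolding PB using ij by (simp add: Q_def scalar_prod_def)
    also have "\<dots> = (\<Sum>k = 0..<n. (if vs ! j = ws ! k then 1 else 0) * adj_entry \<Gamma> (vs ! i) (ws ! k))"
      by (rule sum.cong) auto
    also have "\<dots> = adj_entry \<Gamma> (vs ! i) (vs ! j)"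
      using delta[OF assms(2) lw mem(1)[OF ij(2)], of "\<lambda>x. adj_entry \<Gamma> (vs ! i) x"] by simp
    finally show "A $$ (i, j) = (P * B * Q) $$ (i, j)"
      using ij by (simp add: A_def adj_mat_enum_def n_def)
  qed (use carr in auto)
  then have "similar_mat_wit A B P Q"
    using carr PQ QP by (auto simp: similar_mat_wit_def Let_def)
  then show ?thesis unfolding similar_mat_def A_def B_def by blast
qed

lemma char_poly_adj_mat_enum:
  assumes "distinct vs" "set vs = verts \<Gamma>"
  shows "char_poly (adj_mat \<Gamma>) = char_poly (adj_mat_enum \<Gamma> vs)"
proof -
  have "\<exists>us. distinct us \<and> set us = verts \<Gamma>" using assms by blast
  then have "distinct (SOME us. distinct us \<and> set us = verts \<Gamma>) \<and>
      set (SOME us. distinct us \<and> set us = verts \<Gamma>) = verts \<Gamma>"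
    by (rule someI_ex)
  then show ?thesis
    unfolding adj_mat_def using assms by (intro char_poly_similar similar_adj_mat_enum) auto
qed

end

theory Submission
  imports Defs
begin

text \<open>Let \<open>charge d = min 1 (3 - d)\<close>. Since \<open>\<Gamma>\<close> is connected, the handshake lemma turns
  \<open>n - p - 2 \<theta>\<close> into the sum of the charges of all vertex degrees minus 2. The inertia index
  is bounded from below by the length \<open>k\<close> of a sequence of disjoint edges \<open>u\<^sub>i v\<^sub>i\<close> in which each
  \<open>v\<^sub>i\<close> is adjacent to no vertex of the previous edges: eliminating \<open>v\<^sub>i\<close> shows that every edge
  adds one negative square to the quadratic form of the adjacency matrix. So it suffices to find
  long sequences, and this goes by induction on connected induced subgraphs. A pendant vertex is
  removed together with its neighbour \<open>u\<close>; the remaining components all meet the neighbourhood of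
  \<open>u\<close>, which bounds their number. Without pendant vertices one removes a vertex that is not a cut
  vertex. If two distinct cycles meet, they have a common vertex \<open>x\<close> at which their edges differ,
  and removing \<open>x\<close> leaves at most \<open>deg x - 2\<close> components, which gives the improved bound.\<close>

section \<open>Connected induced subgraphs\<close>

text \<open>The set holds the vertices used or passed over so far, and \<open>weaken\<close> passes
  over vertices without adding an edge. Only \<open>v\<close> is restricted in \<open>pair\<close>;
  \<open>u\<close> may be adjacent to anything in \<open>S\<close>. A pendant vertex
  \<open>v\<close> with its neighbour \<open>u\<close> always qualifies.\<close>

inductive nested_matching :: "'a set set \<Rightarrow> 'a set \<Rightarrow> nat \<Rightarrow> bool" for E where
  empty: "nested_matching E {} 0"
| weaken: "nested_matching E S k \<Longrightarrow> S \<subseteq> S' \<Longrightarrow> nested_matching E S' k"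
| pair: "nested_matching E S k \<Longrightarrow> {u, v} \<in> E \<Longrightarrow> u \<noteq> v \<Longrightarrow> u \<notin> S \<Longrightarrow> v \<notin> S \<Longrightarrow>
    \<forall>w\<in>S. {v, w} \<notin> E \<Longrightarrow> nested_matching E (insert u (insert v S)) (Suc k)"

definition adj_rel :: "'a set set \<Rightarrow> 'a set \<Rightarrow> ('a \<times> 'a) set" where
  "adj_rel E S = {(x, y). x \<in> S \<and> y \<in> S \<and> {x, y} \<in> E}"

definition conn :: "'a set set \<Rightarrow> 'a set \<Rightarrow> bool" where
  "conn E S \<longleftrightarrow> S \<noteq> {} \<and> (\<forall>x\<in>S. \<forall>y\<in>S. (x, y) \<in> (adj_rel E S)\<^sup>*)"

text \<open>Such a set is a union of components of the graph induced on \<open>T\<close>. Together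
  with \<open>conn E C\<close> it makes \<open>C\<close> a single component, so no equivalence
  classes are formed.\<close>

definition closed_in :: "'a set set \<Rightarrow> 'a set \<Rightarrow> 'a set \<Rightarrow> bool" where
  "closed_in E T C \<longleftrightarrow> C \<subseteq> T \<and> (\<forall>x\<in>C. \<forall>y\<in>T - C. {x, y} \<notin> E)"

definition nbrs :: "'a set set \<Rightarrow> 'a set \<Rightarrow> 'a \<Rightarrow> 'a set" where
  "nbrs E S v = {w \<in> S. {v, w} \<in> E}"

abbreviation deg_in :: "'a set set \<Rightarrow> 'a set \<Rightarrow> 'a \<Rightarrow> nat" where
  "deg_in E S v \<equiv> card (nbrs E S v)"

text \<open>For degrees \<open>d >= 1\<close> the value is 3 - d, lowered by one if d = 1, which is
  how pendant vertices enter the sum. The cap keeps the function antitone down to degree 0, so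
  charges never drop when vertices are deleted.\<close>

definition charge :: "nat \<Rightarrow> int" where
  "charge d = min 1 (3 - int d)"

text \<open>The edges of \<open>A\<close> are appended after those of \<open>B\<close>: no vertex of
  \<open>A\<close> sees \<open>B\<close>, so the condition on \<open>v\<close> survives.\<close>

lemma nested_matching_union:
  assumes "nested_matching E A a" "nested_matching E B b" "A \<inter> B = {}"
    "\<forall>x\<in>A. \<forall>y\<in>B. {x, y} \<notin> E"
  shows "nested_matching E (A \<union> B) (a + b)"
  using assms(1,3,4)
proof induction
  case empty
  then show ?case using assms(2) by simp
next
  case (weaken S k S')
  then have "nested_matching E (S \<union> B) (k + b)" by blast
  then show ?case by (rule nested_matching.weaken) (use weaken in blast)
next
  case (pair S k u v)
  have "nested_matching E (insert u (insert v (S \<union> B))) (Suc (k + b))"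
    by (rule nested_matching.pair) (use pair in auto)
  then show ?case by simp
qed

section \<open>Connectivity and components inside a vertex set\<close>

lemma adj_rel_mono: "S \<subseteq> T \<Longrightarrow> adj_rel E S \<subseteq> adj_rel E T"
  by (auto simp: adj_rel_def)

lemma adj_rel_sym: "(x, y) \<in> (adj_rel E S)\<^sup>* \<Longrightarrow> (y, x) \<in> (adj_rel E S)\<^sup>*"
  by (rule symD[OF sym_rtrancl]) (auto simp: adj_rel_def sym_def insert_commute)

lemma closed_in_rtrancl:
  assumes "closed_in E T C" "(x, y) \<in> (adj_rel E T)\<^sup>*" "x \<in> C"
  shows "y \<in> C"
  using assms(2,3)
  by induction (use assms(1) in \<open>auto simp: closed_in_def adj_rel_def\<close>)

lemma conn_closed_in:
  assumes "conn E T" "closed_in E T C" "C \<noteq> {}"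
  shows "C = T"
proof
  show "C \<subseteq> T" using assms(2) by (simp add: closed_in_def)
  show "T \<subseteq> C"
  proof
    fix y assume "y \<in> T"
    moreover obtain x where "x \<in> C" using assms(3) by blast
    ultimately have "(x, y) \<in> (adj_rel E T)\<^sup>*"
      using assms(1) \<open>C \<subseteq> T\<close> by (auto simp: conn_def)
    then show "y \<in> C" using closed_in_rtrancl[OF assms(2)] \<open>x \<in> C\<close> by blast
  qed
qed

lemma conn_singleton [simp]: "conn E {x}"
  by (simp add: conn_def)

lemma conn_insert:
  assumes "conn E C" "x \<in> C" "{x, y} \<in> E"
  shows "conn E (insert y C)"
proof -
  have m: "(adj_rel E C)\<^sup>* \<subseteq> (adj_rel E (insert y C))\<^sup>*"
    by (intro rtrancl_mono adj_rel_mono) auto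
  have x: "(x, z) \<in> (adj_rel E (insert y C))\<^sup>*" if "z \<in> insert y C" for z
  proof (cases "z \<in> C")
    case True
    then show ?thesis using m assms by (auto simp: conn_def)
  next
    case False
    then have "(x, z) \<in> adj_rel E (insert y C)" using that assms by (auto simp: adj_rel_def)
    then show ?thesis by blast
  qed
  then show ?thesis
    unfolding conn_def by (meson adj_rel_sym insert_not_empty rtrancl_trans)
qed

text \<open>An edge leaving a maximal connected subset would allow its endpoint to be added.\<close>

lemma exists_component:
  assumes "finite T" "T \<noteq> {}"
  shows "\<exists>C. conn E C \<and> closed_in E T C"
proof -
  define F where "F = {C. C \<subseteq> T \<and> conn E C}"
  have "finite F" unfolding F_def using assms by simp
  moreover from assms obtain x where "x \<in> T" by blast
  then have "{x} \<in> F" by (simp add: F_def)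
  ultimately obtain C where C: "C \<in> F" "\<And>D. D \<in> F \<Longrightarrow> C \<subseteq> D \<Longrightarrow> C = D"
    using finite_has_maximal[of F] by blast
  have "{x, y} \<notin> E" if "x \<in> C" "y \<in> T - C" for x y
    using C(2)[of "insert y C"] conn_insert[of E C x y] that C(1) by (auto simp: F_def)
  then show ?thesis using C(1) by (auto simp: F_def closed_in_def)
qed

text \<open>Let \<open>C\<close> be a maximal connected proper subset. Some edge leaves
  \<open>C\<close>, and adding its endpoint \<open>y\<close> keeps the set connected, so by
  maximality \<open>y\<close> is all that \<open>C\<close> misses.\<close>

lemma exists_non_cut_vertex:
  assumes "finite S" "conn E S" "\<not> is_singleton S"
  shows "\<exists>x\<in>S. conn E (S - {x})"
proof -
  define F where "F = {C. C \<subset> S \<and> conn E C}"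
  have "F \<subseteq> Pow S" by (auto simp: F_def)
  then have "finite F" using assms by (meson finite_Pow_iff finite_subset)
  moreover from assms obtain x where "x \<in> S" by (auto simp: conn_def)
  then have "{x} \<in> F" using assms by (auto simp: F_def is_singleton_def)
  ultimately obtain C where C: "C \<in> F" "\<And>D. D \<in> F \<Longrightarrow> C \<subseteq> D \<Longrightarrow> C = D"
    using finite_has_maximal[of F] by blast
  have "\<not> closed_in E S C"
    using conn_closed_in[OF assms(2), of C] C(1) by (auto simp: F_def conn_def)
  then obtain x y where xy: "x \<in> C" "y \<in> S - C" "{x, y} \<in> E"
    using C(1) by (auto simp: closed_in_def F_def)
  have "conn E (insert y C)" using conn_insert[of E C x y] xy C(1) by (auto simp: F_def)
  then have "insert y C = S" using C(2)[of "insert y C"] xy C(1) by (auto simp: F_def)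
  then have "S - {y} = C" using xy by auto
  then show ?thesis using C(1) xy by (auto simp: F_def)
qed

section \<open>The charge bound for connected vertex sets\<close>

lemma deg_in_mono: "finite T \<Longrightarrow> S \<subseteq> T \<Longrightarrow> deg_in E S v \<le> deg_in E T v"
  by (intro card_mono) (auto simp: nbrs_def)

lemma charge_antimono: "d \<le> d' \<Longrightarrow> charge d' \<le> charge d"
  by (auto simp: charge_def)

abbreviation leafy :: "'a set set \<Rightarrow> 'a set \<Rightarrow> bool" where
  "leafy E S \<equiv> \<exists>v\<in>S. deg_in E S v \<le> 1"

text \<open>The extra unit lost without a vertex of degree at most one is unavoidable: a cycle of
  length 4 has charge sum 4, but its nested matchings have at most one edge.\<close>

definition charge_bound :: "'a set set \<Rightarrow> 'a set \<Rightarrow> bool" where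
  "charge_bound E S \<longleftrightarrow> (\<exists>k. nested_matching E S k \<and>
     2 * int k \<ge> (\<Sum>v\<in>S. charge (deg_in E S v)) - 1 - of_bool (\<not> leafy E S))"

text \<open>Every component loses one unit in its own bound, and disjoint components that all meet
  \<open>K\<close> number at most \<open>card K\<close>. The weight \<open>h\<close> stands for
  charges measured in a larger vertex set; its deficit against the charges in \<open>C\<close>
  covers the extra unit of a component that is not leafy.\<close>

lemma nested_matching_components:
  assumes "finite T" "finite K"
    and "\<And>C. C \<subseteq> T \<Longrightarrow> conn E C \<Longrightarrow> charge_bound E C"
    and "\<And>C. conn E C \<Longrightarrow> closed_in E T C \<Longrightarrow> C \<inter> K \<noteq> {} \<and>
      (\<Sum>v\<in>C. h v) \<le> (\<Sum>v\<in>C. charge (deg_in E C v)) - of_bool (\<not> leafy E C)"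
  shows "\<exists>k. nested_matching E T k \<and> 2 * int k \<ge> (\<Sum>v\<in>T. h v) - int (card K)"
  using assms
proof (induction "card T" arbitrary: T K rule: less_induct)
  case less
  show ?case
  proof (cases "T = {}")
    case True
    then show ?thesis using nested_matching.empty by fastforce
  next
    case False
    then obtain C where C: "conn E C" "closed_in E T C"
      using exists_component less.prems(1) by blast
    then have CT: "C \<subseteq> T" "C \<noteq> {}" by (auto simp: closed_in_def conn_def)
    have lt: "card (T - C) < card T"
      using CT less.prems(1) by (intro psubset_card_mono) auto
    obtain k1 where k1: "nested_matching E C k1"
      "2 * int k1 \<ge> (\<Sum>v\<in>C. charge (deg_in E C v)) - 1 - of_bool (\<not> leafy E C)"
      using less.prems(3)[OF CT(1) C(1)] by (auto simp: charge_bound_def)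
    have C4: "C \<inter> K \<noteq> {}"
      "(\<Sum>v\<in>C. h v) \<le> (\<Sum>v\<in>C. charge (deg_in E C v)) - of_bool (\<not> leafy E C)"
      using less.prems(4)[OF C] by auto
    have "\<exists>k. nested_matching E (T - C) k \<and>
        2 * int k \<ge> (\<Sum>v\<in>T - C. h v) - int (card (K - C))"
    proof (rule less.hyps[OF lt])
      fix D assume D: "conn E D" "closed_in E (T - C) D"
      have "closed_in E T D"
        unfolding closed_in_def
      proof (intro conjI ballI)
        fix p q assume p: "p \<in> D" and q: "q \<in> T - D"
        show "{p, q} \<notin> E"
        proof (cases "q \<in> C")
          case True
          then have "{q, p} \<notin> E" using C(2) D(2) p by (auto simp: closed_in_def)
          then show ?thesis by (simp add: insert_commute)
        qed (use D(2) p q in \<open>auto simp: closed_in_def\<close>)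
      qed (use D(2) in \<open>auto simp: closed_in_def\<close>)
      moreover have "D \<inter> (K - C) = D \<inter> K" using D(2) by (auto simp: closed_in_def)
      ultimately show "D \<inter> (K - C) \<noteq> {} \<and>
          (\<Sum>v\<in>D. h v) \<le> (\<Sum>v\<in>D. charge (deg_in E D v)) - of_bool (\<not> leafy E D)"
        using less.prems(4)[OF D(1)] by simp
    qed (use less.prems in auto)
    then obtain k2 where k2: "nested_matching E (T - C) k2"
      "2 * int k2 \<ge> (\<Sum>v\<in>T - C. h v) - int (card (K - C))" by blast
    have "nested_matching E (C \<union> (T - C)) (k1 + k2)"
      by (rule nested_matching_union[OF k1(1) k2(1)]) (use C(2) in \<open>auto simp: closed_in_def\<close>)
    moreover have "C \<union> (T - C) = T" using CT by auto
    moreover have "(\<Sum>v\<in>T. h v) = (\<Sum>v\<in>C. h v) + (\<Sum>v\<in>T - C. h v)"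
      using CT(1) less.prems(1) by (simp add: sum.subset_diff)
    \<comment> \<open>A vertex of \<open>K\<close> in \<open>C\<close> pays for the unit lost in
      \<open>C\<close>; the induction hypothesis uses only \<open>K - C\<close>.\<close>
    moreover have "card (K - C) < card K"
      using C4(1) less.prems(2) by (intro psubset_card_mono) auto
    ultimately have "nested_matching E T (k1 + k2)"
      "2 * int (k1 + k2) \<ge> (\<Sum>v\<in>T. h v) - int (card K)"
      using k1(2) k2(2) C4(2) by auto
    then show ?thesis by blast
  qed
qed

text \<open>By connectedness of \<open>S\<close> some edge leaves \<open>C\<close>. It must end in
  \<open>X\<close>, and \<open>x\<close> is the only vertex of \<open>X\<close> that can have
  neighbours outside \<open>X\<close>.\<close>

lemma component_meets_nbrs:
  assumes "conn E S" "x \<in> X" "X \<subseteq> S" "\<forall>y\<in>X - {x}. \<forall>z\<in>S - X. {y, z} \<notin> E"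
    and "conn E C" "closed_in E (S - X) C"
  shows "\<exists>y\<in>C. y \<in> nbrs E (S - X) x"
proof -
  have C: "C \<subseteq> S - X" "C \<noteq> {}" using assms by (auto simp: closed_in_def conn_def)
  then have "\<not> closed_in E S C" using conn_closed_in[OF assms(1)] assms(2,3) by blast
  then obtain y z where yz: "y \<in> C" "z \<in> S - C" "{y, z} \<in> E"
    using C by (auto simp: closed_in_def)
  then have "z \<in> X" using assms(6) by (auto simp: closed_in_def)
  moreover have "y \<in> S - X" "{z, y} \<in> E" using yz C by (auto simp: insert_commute)
  ultimately have "z = x" using assms(4) by blast
  then show ?thesis using yz C by (auto simp: nbrs_def insert_commute)
qed

text \<open>A component without vertices of degree at most one loses one more unit in its own bound,
  but this is compensated: its contact vertex with \<open>x\<close> has degree at least three in \<open>S\<close>, so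
  its charge in \<open>S\<close> is smaller than in the component.\<close>

lemma nested_matching_remove:
  assumes S: "finite S" "conn E S" and X: "x \<in> X" "X \<subseteq> S"
    "\<forall>y\<in>X - {x}. \<forall>z\<in>S - X. {y, z} \<notin> E"
    and bound: "\<And>C. C \<subseteq> S - X \<Longrightarrow> conn E C \<Longrightarrow> charge_bound E C"
    and K: "finite K" "\<And>C. conn E C \<Longrightarrow> closed_in E (S - X) C \<Longrightarrow> C \<inter> K \<noteq> {}"
  shows "\<exists>k. nested_matching E (S - X) k \<and>
    2 * int k \<ge> (\<Sum>v\<in>S - X. charge (deg_in E S v)) - int (card K)"
proof (rule nested_matching_components)
  fix C assume C: "conn E C" "closed_in E (S - X) C"
  then have CS: "C \<subseteq> S" and fin: "finite C"
    using S(1) by (auto simp: closed_in_def intro: finite_subset)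
  have le: "charge (deg_in E S v) \<le> charge (deg_in E C v)" for v
    by (intro charge_antimono deg_in_mono S CS)
  have "(\<Sum>v\<in>C. charge (deg_in E S v)) < (\<Sum>v\<in>C. charge (deg_in E C v))" if "\<not> leafy E C"
  proof (rule sum_strict_mono_ex1[OF fin])
    obtain y where y: "y \<in> C" "y \<in> nbrs E (S - X) x"
      using component_meets_nbrs[OF S(2) X C] by blast
    have "insert x (nbrs E C y) \<subseteq> nbrs E S y"
      using y CS X by (auto simp: nbrs_def insert_commute)
    then have "card (insert x (nbrs E C y)) \<le> deg_in E S y"
      using S(1) by (intro card_mono) (auto simp: nbrs_def)
    moreover have "x \<notin> nbrs E C y" using C(2) X(1) by (auto simp: nbrs_def closed_in_def)
    ultimately have "Suc (deg_in E C y) \<le> deg_in E S y"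
      using fin by (simp add: nbrs_def)
    then show "\<exists>y\<in>C. charge (deg_in E S y) < charge (deg_in E C y)"
      using that y(1) by (force simp: charge_def)
  qed (use le in auto)
  then show "C \<inter> K \<noteq> {} \<and> (\<Sum>v\<in>C. charge (deg_in E S v))
      \<le> (\<Sum>v\<in>C. charge (deg_in E C v)) - of_bool (\<not> leafy E C)"
    using K(2)[OF C] sum_mono[of C, OF le] by auto
qed (use S K(1) bound in auto)

lemma charge_bound_conn:
  assumes "finite S" "conn E S" and loopless: "\<And>x. {x} \<notin> E"
  shows "charge_bound E S"
  using assms(1,2)
proof (induction "card S" arbitrary: S rule: less_induct)
  case less
  note S = less.prems
  have sub: "charge_bound E C" if "C \<subseteq> S - X" "conn E C" "X \<noteq> {}" "X \<subseteq> S" for C X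
  proof (rule less.hyps)
    show "card C < card S" using that S by (intro psubset_card_mono) auto
    show "finite C" "conn E C" using that S by (auto intro: finite_subset)
  qed
  show ?case
  proof (cases "is_singleton S")
    case True
    then obtain x where "S = {x}" by (auto simp: is_singleton_def)
    moreover have "nested_matching E S 0"
      by (rule nested_matching.weaken[OF nested_matching.empty]) simp
    moreover have "nbrs E {x} x = {}" using loopless by (auto simp: nbrs_def)
    ultimately show ?thesis by (auto simp: charge_bound_def charge_def intro!: exI[of _ 0])
  next
    case nsing: False
    have nonempty: "nbrs E S v \<noteq> {}" if "v \<in> S" for v
    proof
      assume "nbrs E S v = {}"
      then have "closed_in E S {v}" using that by (auto simp: closed_in_def nbrs_def)
      then show False using conn_closed_in[OF S(2)] nsing by auto
    qed
    show ?thesis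
    proof (cases "leafy E S")
      case True
      then obtain v where v: "v \<in> S" "deg_in E S v \<le> 1" by blast
      moreover have "finite (nbrs E S v)" using S by (simp add: nbrs_def)
      ultimately have "deg_in E S v = 1" using nonempty[of v] by (simp add: le_Suc_eq)
      then obtain u where u: "nbrs E S v = {u}" by (auto simp: card_1_singleton_iff)
      then have uS: "u \<in> S" and uv: "{u, v} \<in> E" by (auto simp: nbrs_def insert_commute)
      then have ne: "u \<noteq> v" using loopless by auto
      define T where "T = S - {u, v}"
      \<comment> \<open>Since \<open>v\<close> has no neighbour besides \<open>u\<close>, every
        component of \<open>T\<close> hangs on \<open>u\<close>, so \<open>K\<close> meets all of
        them.\<close>
      define K where "K = nbrs E T u"
      have vT: "\<forall>w\<in>T. {v, w} \<notin> E" using u by (auto simp: nbrs_def T_def)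
      have finK: "finite K" using S by (auto simp: K_def nbrs_def T_def)
      have nu: "nbrs E S u = insert v K"
        using uv v(1) loopless by (auto simp: K_def nbrs_def T_def)
      then have dK: "deg_in E S u = Suc (card K)"
        using finK by (simp add: K_def nbrs_def T_def)
      have "\<exists>k. nested_matching E T k \<and>
          2 * int k \<ge> (\<Sum>v\<in>T. charge (deg_in E S v)) - int (card K)"
        unfolding T_def
      proof (rule nested_matching_remove[OF S, of u])
        fix C assume "conn E C" "closed_in E (S - {u, v}) C"
        then show "C \<inter> K \<noteq> {}"
          using component_meets_nbrs[OF S(2), of u "{u, v}" C] vT uS v(1) by (auto simp: K_def T_def)
      qed (use sub[of _ "{u, v}"] uS v vT finK in \<open>auto simp: T_def\<close>)
      then obtain k where k: "nested_matching E T k"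
        "2 * int k \<ge> (\<Sum>v\<in>T. charge (deg_in E S v)) - int (card K)" by blast
      have Seq: "S = insert u (insert v T)" using uS v(1) by (auto simp: T_def)
      have "nested_matching E (insert u (insert v T)) (Suc k)"
        using nested_matching.pair[OF k(1) uv ne _ _ vT] by (simp add: T_def)
      then have "nested_matching E S (Suc k)" using Seq by simp
      moreover have "(\<Sum>w\<in>S. charge (deg_in E S w)) =
          charge (deg_in E S u) + charge (deg_in E S v) + (\<Sum>w\<in>T. charge (deg_in E S w))"
        using S(1) ne uS v(1) unfolding T_def
        by (simp add: sum.remove[of S u] sum.remove[of "S - {u}" v] Diff_insert2[symmetric])
      \<comment> \<open>As \<open>u\<close> has degree \<open>card K + 1\<close>, its charge plus
        \<open>card K\<close> is at most 2, which the new edge pays for; the charge of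
        \<open>v\<close> is the one unit that remains lost.\<close>
      then have "2 * int (Suc k) \<ge> (\<Sum>w\<in>S. charge (deg_in E S w)) - 1"
        using k(2) dK by (simp add: charge_def)
      ultimately show ?thesis using True unfolding charge_bound_def by (intro exI[of _ "Suc k"]) auto
    next
      case False
      obtain x where x: "x \<in> S" "conn E (S - {x})"
        using exists_non_cut_vertex[OF S nsing] by blast
      \<comment> \<open>The set \<open>S - {x}\<close> is its own only component, so one vertex in
        it is enough to meet all components.\<close>
      obtain y where y: "y \<in> nbrs E S x" using nonempty[OF x(1)] by blast
      have yT: "y \<in> S - {x}" using y loopless by (auto simp: nbrs_def)
      have "\<exists>k. nested_matching E (S - {x}) k \<and>
          2 * int k \<ge> (\<Sum>v\<in>S - {x}. charge (deg_in E S v)) - int (card {y})"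
      proof (rule nested_matching_remove[OF S, of x])
        fix C assume "conn E C" "closed_in E (S - {x}) C"
        then have "C = S - {x}" using conn_closed_in[OF x(2)] by (auto simp: conn_def)
        then show "C \<inter> {y} \<noteq> {}" using yT by auto
      qed (use x(1) sub[of _ "{x}"] in auto)
      then obtain k where k: "nested_matching E (S - {x}) k"
        "2 * int k \<ge> (\<Sum>v\<in>S - {x}. charge (deg_in E S v)) - 1" by auto
      have "nested_matching E S k" by (rule nested_matching.weaken[OF k(1)]) auto
      \<comment> \<open>Dropping \<open>x\<close> unmatched costs at most one unit, exactly the
        extra loss that \<open>charge_bound\<close> grants when \<open>S\<close> is not
        leafy.\<close>
      moreover have "charge (deg_in E S x) \<le> 1" by (simp add: charge_def)
      ultimately show ?thesis
        using k(2) False S(1) x(1) unfolding charge_bound_def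
        by (intro exI[of _ k]) (auto simp: sum.remove[of S x])
    qed
  qed
qed

text \<open>After removal of \<open>x\<close>, a component containing \<open>b1\<close> or
  \<open>b2\<close> also contains \<open>a1\<close> or \<open>a2\<close> respectively. Hence the
  neighbours of \<open>x\<close> other than \<open>b1\<close> and \<open>b2\<close> still meet every
  component, which bounds their number by the degree minus 2. The vertices \<open>a1\<close> and
  \<open>a2\<close> may coincide.\<close>

lemma nested_matching_branch_vertex:
  assumes S: "finite S" "conn E S" and loopless: "\<And>x. {x} \<notin> E" and x: "x \<in> S"
    and b: "{a1, b1, a2, b2} \<subseteq> nbrs E S x" "b1 \<noteq> b2" "a1 \<notin> {b1, b2}" "a2 \<notin> {b1, b2}"
    and path: "(a1, b1) \<in> (adj_rel E (S - {x}))\<^sup>*" "(a2, b2) \<in> (adj_rel E (S - {x}))\<^sup>*"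
  shows "\<exists>k. nested_matching E S k \<and> 2 * int k \<ge> (\<Sum>v\<in>S. charge (deg_in E S v)) - 1"
proof -
  define K where "K = nbrs E S x - {b1, b2}"
  have fin: "finite (nbrs E S x)" using S by (simp add: nbrs_def)
  have aK: "a1 \<in> K" "a2 \<in> K" using b by (auto simp: K_def)
  have "\<exists>k. nested_matching E (S - {x}) k \<and>
      2 * int k \<ge> (\<Sum>v\<in>S - {x}. charge (deg_in E S v)) - int (card K)"
  proof (rule nested_matching_remove[OF S, of x])
    fix C assume C: "conn E C" "closed_in E (S - {x}) C"
    then obtain y where y: "y \<in> C" "y \<in> nbrs E S x"
      using component_meets_nbrs[OF S(2), of x "{x}" C] x by (auto simp: nbrs_def)
    have "b1 \<in> C \<Longrightarrow> a1 \<in> C" "b2 \<in> C \<Longrightarrow> a2 \<in> C"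
      using closed_in_rtrancl[OF C(2)] adj_rel_sym path by metis+
    then show "C \<inter> K \<noteq> {}" using y aK by (auto simp: K_def)
  next
    fix C assume "C \<subseteq> S - {x}" "conn E C"
    then show "charge_bound E C" using S by (intro charge_bound_conn loopless) (auto intro: finite_subset)
  qed (use x fin in \<open>auto simp: K_def\<close>)
  then obtain k where k: "nested_matching E (S - {x}) k"
    "2 * int k \<ge> (\<Sum>v\<in>S - {x}. charge (deg_in E S v)) - int (card K)" by auto
  have "card K = deg_in E S x - 2"
    unfolding K_def using b fin by (subst card_Diff_subset) auto
  \<comment> \<open>This makes the natural subtraction of 2 exact.\<close>
  moreover have "card {b1, b2} \<le> deg_in E S x" using fin b by (intro card_mono) auto
  ultimately have "charge (deg_in E S x) + int (card K) \<le> 1" using b(2) by (simp add: charge_def)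
  moreover have "nested_matching E S k" by (rule nested_matching.weaken[OF k(1)]) auto
  ultimately show ?thesis
    using k(2) S(1) x by (intro exI[of _ k]) (auto simp: sum.remove[of S x])
qed

section \<open>Degrees and cycles\<close>

lemma adj_rel_verts:
  assumes "signed_graph \<Gamma>"
  shows "adj_rel (edges \<Gamma>) (verts \<Gamma>) = {(x, y). {x, y} \<in> edges \<Gamma>}"
  using assms by (auto simp: adj_rel_def signed_graph_def)

lemma loopless: "signed_graph \<Gamma> \<Longrightarrow> {x} \<notin> edges \<Gamma>"
  by (auto simp: signed_graph_def)

lemma conn_verts:
  assumes "signed_graph \<Gamma>" "connected_graph \<Gamma>"
  shows "conn (edges \<Gamma>) (verts \<Gamma>)"
  using assms(2) unfolding conn_def connected_graph_def adj_rel_verts[OF assms(1)] reachable_def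
  by simp

lemma finite_edges: "signed_graph \<Gamma> \<Longrightarrow> finite (edges \<Gamma>)"
  by (rule finite_subset[of _ "Pow (verts \<Gamma>)"]) (auto simp: signed_graph_def)

lemma deg_in_verts:
  assumes "signed_graph \<Gamma>"
  shows "deg_in (edges \<Gamma>) (verts \<Gamma>) v = vertex_degree \<Gamma> v"
proof -
  have "{e \<in> edges \<Gamma>. v \<in> e} = (\<lambda>w. {v, w}) ` nbrs (edges \<Gamma>) (verts \<Gamma>) v"
  proof (intro equalityI subsetI)
    fix e assume "e \<in> {e \<in> edges \<Gamma>. v \<in> e}"
    moreover from this have "card e = 2" "v \<in> e" using assms by (auto simp: signed_graph_def)
    then obtain w where "e = {v, w}" by (auto simp: card_2_iff)
    ultimately show "e \<in> (\<lambda>w. {v, w}) ` nbrs (edges \<Gamma>) (verts \<Gamma>) v"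
      using assms by (auto simp: nbrs_def signed_graph_def)
  qed (auto simp: nbrs_def)
  moreover have "inj_on (\<lambda>w. {v, w}) (nbrs (edges \<Gamma>) (verts \<Gamma>) v)"
    by (auto simp: inj_on_def doubleton_eq_iff)
  ultimately show ?thesis by (simp add: vertex_degree_def card_image)
qed

lemma handshake:
  assumes "signed_graph \<Gamma>"
  shows "(\<Sum>v\<in>verts \<Gamma>. vertex_degree \<Gamma> v) = 2 * card (edges \<Gamma>)"
proof -
  have fV: "finite (verts \<Gamma>)" using assms by (simp add: signed_graph_def)
  have "(\<Sum>v\<in>verts \<Gamma>. vertex_degree \<Gamma> v) = (\<Sum>v\<in>verts \<Gamma>. \<Sum>e\<in>edges \<Gamma>. of_bool (v \<in> e))"
    using finite_edges[OF assms] by (simp add: vertex_degree_def Int_def)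
  also have "\<dots> = (\<Sum>e\<in>edges \<Gamma>. \<Sum>v\<in>verts \<Gamma>. of_bool (v \<in> e))"
    by (rule sum.swap)
  also have "\<dots> = (\<Sum>e\<in>edges \<Gamma>. 2)"
  proof (rule sum.cong)
    fix e assume "e \<in> edges \<Gamma>"
    then have "card e = 2" "verts \<Gamma> \<inter> e = e" using assms by (auto simp: signed_graph_def)
    then show "(\<Sum>v\<in>verts \<Gamma>. of_bool (v \<in> e)) = (2::nat)" using fV by (simp add: Int_def)
  qed simp
  finally show ?thesis by simp
qed

lemma cyclomatic_connected:
  assumes "connected_graph \<Gamma>"
  shows "cyclomatic \<Gamma> = int (card (edges \<Gamma>)) - int (card (verts \<Gamma>)) + 1"
proof -
  have "reachable \<Gamma> = verts \<Gamma> \<times> verts \<Gamma>"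
    using assms by (auto simp: connected_graph_def reachable_def)
  then have "components \<Gamma> = {verts \<Gamma>}"
    using assms by (auto simp: components_def quotient_def connected_graph_def)
  then show ?thesis by (simp add: cyclomatic_def)
qed

text \<open>A connected graph of order at least 2 has no vertex of degree 0, so each charge is 3 -
  d, minus one at pendant vertices. Summing gives 3n - p - 2|E| by the handshake lemma, and one
  component turns |E| into the cyclomatic number plus n - 1.\<close>

lemma sum_charge:
  assumes "signed_graph \<Gamma>" "connected_graph \<Gamma>" "graph_order \<Gamma> \<ge> 2"
  shows "(\<Sum>v\<in>verts \<Gamma>. charge (deg_in (edges \<Gamma>) (verts \<Gamma>) v)) =
    int (graph_order \<Gamma>) - int (num_pendant \<Gamma>) - 2 * cyclomatic \<Gamma> + 2"
proof -
  let ?V = "verts \<Gamma>"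
  have fV: "finite ?V" using assms by (simp add: signed_graph_def)
  have deg: "vertex_degree \<Gamma> v \<ge> 1" if "v \<in> ?V" for v
  proof (rule ccontr)
    assume "\<not> vertex_degree \<Gamma> v \<ge> 1"
    then have "deg_in (edges \<Gamma>) ?V v = 0" using deg_in_verts[OF assms(1), of v] by simp
    moreover have "finite (nbrs (edges \<Gamma>) ?V v)" using fV by (simp add: nbrs_def)
    ultimately have "nbrs (edges \<Gamma>) ?V v = {}" by simp
    then have "closed_in (edges \<Gamma>) ?V {v}" using that by (auto simp: closed_in_def nbrs_def)
    then have "?V = {v}" using conn_closed_in[OF conn_verts[OF assms(1,2)]] by blast
    then show False using assms(3) by (simp add: graph_order_def)
  qed
  have "(\<Sum>v\<in>?V. charge (deg_in (edges \<Gamma>) ?V v)) =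
      (\<Sum>v\<in>?V. 3 - of_bool (vertex_degree \<Gamma> v = 1) - int (vertex_degree \<Gamma> v))"
    by (rule sum.cong) (use deg in \<open>auto simp: charge_def deg_in_verts[OF assms(1)] of_bool_def dest: deg\<close>)
  also have "\<dots> = 3 * int (card ?V) - int (num_pendant \<Gamma>) - int (\<Sum>v\<in>?V. vertex_degree \<Gamma> v)"
    using fV by (simp add: sum_subtractf num_pendant_def Int_def)
  finally show ?thesis
    using handshake[OF assms(1)] cyclomatic_connected[OF assms(2)] by (simp add: graph_order_def)
qed

section \<open>Cycles and their behaviour at common vertices\<close>

lemma cycle_edgesE:
  assumes "e \<in> cycle_edges c"
  obtains i where "i < length c" "e = {c ! i, c ! (Suc i mod length c)}"
  using assms by (auto simp: cycle_edges_def)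

lemma cycle_edges_rotate_subset: "cycle_edges (rotate m c) \<subseteq> cycle_edges c"
proof
  fix e assume "e \<in> cycle_edges (rotate m c)"
  then obtain i where i: "i < length c"
    "e = {rotate m c ! i, rotate m c ! (Suc i mod length c)}"
    by (auto simp: cycle_edges_def)
  define j where "j = (m + i) mod length c"
  have pos: "0 < length c" using i(1) by (cases c) auto
  then have "j < length c" by (simp add: j_def)
  moreover have "Suc i mod length c < length c" using pos by simp
  then have "rotate m c ! (Suc i mod length c) = c ! (Suc j mod length c)"
    by (simp add: nth_rotate j_def mod_simps)
  moreover have "rotate m c ! i = c ! j" using i(1) by (simp add: nth_rotate j_def)
  ultimately show "e \<in> cycle_edges c" using i(2) by (auto simp: cycle_edges_def)
qed

text \<open>Rotating back is again a rotation, so the inclusion already shown yields its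
  converse.\<close>

lemma cycle_edges_rotate: "cycle_edges (rotate m c) = cycle_edges c"
proof
  have "rotate (length c - m mod length c) (rotate m c) = c"
  proof (cases "c = []")
    case False
    then have "m mod length c < length c" by simp
    then have "(length c - m mod length c + m mod length c) mod length c = 0" by simp
    then have "(length c - m mod length c + m) mod length c = 0" by (simp only: mod_simps)
    then show ?thesis by (simp add: rotate_rotate rotate_id)
  qed simp
  then show "cycle_edges c \<subseteq> cycle_edges (rotate m c)"
    using cycle_edges_rotate_subset[of "length c - m mod length c" "rotate m c"] by simp
qed (rule cycle_edges_rotate_subset)

definition cycle_nbrs :: "'a list \<Rightarrow> 'a \<Rightarrow> 'a set" where
  "cycle_nbrs c x = {y. {x, y} \<in> cycle_edges c}"

lemma cycle_nbrs_head:
  assumes "distinct (x # r)" "length r \<ge> 2"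
  shows "cycle_nbrs (x # r) x = {r ! 0, r ! (length r - 1)}"
proof -
  let ?c = "x # r"
  have inj: "?c ! i = ?c ! j \<longleftrightarrow> i = j" if "i < length ?c" "j < length ?c" for i j
    using assms(1) that by (rule nth_eq_iff_index_eq)
  have "y \<in> {r ! 0, r ! (length r - 1)}" if "{x, y} \<in> cycle_edges ?c" for y
  proof -
    from that obtain i where i: "i < length ?c" "{x, y} = {?c ! i, ?c ! (Suc i mod length ?c)}"
      by (rule cycle_edgesE)
    have lt: "Suc i mod length ?c < length ?c" by simp
    consider "x = ?c ! i" "y = ?c ! (Suc i mod length ?c)" |
      "y = ?c ! i" "x = ?c ! (Suc i mod length ?c)"
      using i(2) by (auto simp: doubleton_eq_iff)
    then show ?thesis
    proof cases
      case 1
      then have "i = 0" using inj[of 0 i] i(1) by simp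
      then show ?thesis using 1 assms(2) by auto
    next
      case 2
      then have "Suc i mod length ?c = 0" using inj[of 0, OF _ lt] by simp
      then have "i = length r" using i(1) by (metis Suc_lessI length_Cons mod_less nat.distinct(1) nat.inject)
      then show ?thesis using 2 assms(2) by (auto simp: nth_Cons')
    qed
  qed
  moreover have "{x, r ! 0} \<in> cycle_edges ?c"
    unfolding cycle_edges_def using assms(2) by (auto intro!: exI[of _ 0])
  moreover have "{?c ! length r, ?c ! (Suc (length r) mod length ?c)} \<in> cycle_edges ?c"
    unfolding cycle_edges_def by (auto simp del: nth_Cons_Suc)
  then have "{x, r ! (length r - 1)} \<in> cycle_edges ?c"
    using assms(2) by (cases "r = []") (auto simp: nth_Cons' insert_commute)
  ultimately show ?thesis unfolding cycle_nbrs_def by blast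
qed

text \<open>Rotate the list until \<open>x\<close> is its head. The tail is then a path avoiding
  \<open>x\<close> between the two cycle neighbours of \<open>x\<close>, which supplies the paths
  required at a branch vertex.\<close>

lemma cycle_nbrs_obtain:
  assumes "signed_graph \<Gamma>" "is_cycle \<Gamma> c" "x \<in> set c"
  obtains p q where "p \<noteq> q" "cycle_nbrs c x = {p, q}"
    "(p, q) \<in> (adj_rel (edges \<Gamma>) (verts \<Gamma> - {x}))\<^sup>*"
proof -
  obtain i where i: "i < length c" "c ! i = x" using assms(3) by (auto simp: in_set_conv_nth)
  have ne: "c \<noteq> []" using assms(3) by auto
  obtain y r where yr: "rotate i c = y # r" using ne by (cases "rotate i c") auto
  have "y = x" using i ne yr hd_rotate_conv_nth[of c i] by simp
  then have c': "rotate i c = x # r" using yr by simp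
  have dist: "distinct (x # r)" using assms(2) c' distinct_rotate[of i c] by (simp add: is_cycle_def)
  have len: "length r \<ge> 2"
    using assms(2) arg_cong[OF c', of length] by (simp add: is_cycle_def)
  have edges: "cycle_edges (x # r) \<subseteq> edges \<Gamma>"
    using assms(2) cycle_edges_rotate[of i c] c' by (simp add: is_cycle_def)
  have step: "(r ! j, r ! Suc j) \<in> adj_rel (edges \<Gamma>) (verts \<Gamma> - {x})" if "Suc j < length r" for j
  proof -
    have "{(x # r) ! Suc j, (x # r) ! (Suc (Suc j) mod length (x # r))} \<in> cycle_edges (x # r)"
      using that unfolding cycle_edges_def by (intro CollectI exI[of _ "Suc j"]) auto
    then have "{r ! j, r ! Suc j} \<in> edges \<Gamma>" using edges that by auto
    moreover have "r ! j \<noteq> x" "r ! Suc j \<noteq> x"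
      using dist that nth_mem[of j r] nth_mem[of "Suc j" r] by auto
    ultimately show ?thesis using assms(1) by (auto simp: adj_rel_def signed_graph_def)
  qed
  have "(r ! 0, r ! j) \<in> (adj_rel (edges \<Gamma>) (verts \<Gamma> - {x}))\<^sup>*" if "j < length r" for j
    using that
  proof (induction j)
    case (Suc j)
    then show ?case using step[of j] by (meson Suc_lessD rtrancl.rtrancl_into_rtrancl)
  qed simp
  then have path: "(r ! 0, r ! (length r - 1)) \<in> (adj_rel (edges \<Gamma>) (verts \<Gamma> - {x}))\<^sup>*"
    using len by simp
  have nb: "cycle_nbrs c x = {r ! 0, r ! (length r - 1)}"
    using cycle_nbrs_head[OF dist len] cycle_edges_rotate[of i c] c' by (simp add: cycle_nbrs_def)
  have ne': "r ! 0 \<noteq> r ! (length r - 1)"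
    using dist len nth_eq_iff_index_eq[of r 0 "length r - 1"] by (cases r) auto
  show thesis by (rule that[OF ne' nb path])
qed

lemma cycle_edges_subset_set: "e \<in> cycle_edges c \<Longrightarrow> e \<subseteq> set c"
proof -
  assume "e \<in> cycle_edges c"
  then obtain i where i: "i < length c" "e = {c ! i, c ! (Suc i mod length c)}"
    by (auto simp: cycle_edges_def)
  moreover from i(1) have "Suc i mod length c < length c" by (intro mod_less_divisor) auto
  ultimately show ?thesis by auto
qed

text \<open>Walk along \<open>c\<close> from a common vertex: the next vertex is a neighbour on
  \<open>c\<close>, hence also on \<open>d\<close>, and so is common again. The walk exhausts
  \<open>c\<close>, and every edge of \<open>c\<close> is then an edge of \<open>d\<close>.\<close>

lemma cycle_subset_if_same_nbrs:
  assumes same: "\<And>x. x \<in> set c \<inter> set d \<Longrightarrow> cycle_nbrs c x = cycle_nbrs d x"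
    and "set c \<inter> set d \<noteq> {}"
  shows "cycle_edges c \<subseteq> cycle_edges d"
proof -
  obtain i where i: "i < length c" "c ! i \<in> set d"
    using assms(2) by (metis IntE all_not_in_conv in_set_conv_nth)
  have step: "c ! ((i + j) mod length c) \<in> set d" for j
  proof (induction j)
    case (Suc j)
    define k where "k = (i + j) mod length c"
    have k: "k < length c" using i(1) unfolding k_def by (intro mod_less_divisor) auto
    then have "{c ! k, c ! (Suc k mod length c)} \<in> cycle_edges c" by (auto simp: cycle_edges_def)
    then have "c ! (Suc k mod length c) \<in> cycle_nbrs d (c ! k)"
      using same[of "c ! k"] Suc k by (auto simp: cycle_nbrs_def k_def)
    then have "c ! (Suc k mod length c) \<in> set d"
      using cycle_edges_subset_set by (auto simp: cycle_nbrs_def)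
    moreover have "Suc k mod length c = (i + Suc j) mod length c"
      by (simp add: k_def mod_simps)
    ultimately show ?case by simp
  qed (use i in simp)
  have "set c \<subseteq> set d"
  proof
    fix x assume "x \<in> set c"
    then obtain j where j: "j < length c" "x = c ! j" by (auto simp: in_set_conv_nth)
    \<comment> \<open>Going round to index 0 and then \<open>j\<close> steps further reaches any
      index \<open>j\<close> from the start \<open>i\<close>.\<close>
    have "(i + (length c - i + j)) mod length c = j" using i(1) j(1) by simp
    then show "x \<in> set d" using step[of "length c - i + j"] j(2) by simp
  qed
  show ?thesis
  proof
    fix e assume e: "e \<in> cycle_edges c"
    then obtain x y where xy: "e = {x, y}" by (auto simp: cycle_edges_def)
    then have "x \<in> set c \<inter> set d" "y \<in> cycle_nbrs c x"
      using cycle_edges_subset_set[OF e] \<open>set c \<subseteq> set d\<close> e by (auto simp: cycle_nbrs_def)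
    then show "e \<in> cycle_edges d" using same xy by (auto simp: cycle_nbrs_def)
  qed
qed

lemma intersecting_cycles_branch:
  assumes "cycle_edges c \<noteq> cycle_edges d" "set c \<inter> set d \<noteq> {}"
  shows "\<exists>x\<in>set c \<inter> set d. cycle_nbrs c x \<noteq> cycle_nbrs d x"
  using cycle_subset_if_same_nbrs[of c d] cycle_subset_if_same_nbrs[of d c] assms
  by (metis Int_commute subset_antisym)

lemma nested_matching_intersecting_cycles:
  assumes G: "signed_graph \<Gamma>" "connected_graph \<Gamma>"
    and cyc: "is_cycle \<Gamma> c" "is_cycle \<Gamma> d" "cycle_edges c \<noteq> cycle_edges d" "set c \<inter> set d \<noteq> {}"
  shows "\<exists>k. nested_matching (edges \<Gamma>) (verts \<Gamma>) k \<and>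
    2 * int k \<ge> (\<Sum>v\<in>verts \<Gamma>. charge (deg_in (edges \<Gamma>) (verts \<Gamma>) v)) - 1"
proof -
  obtain x where x: "x \<in> set c" "x \<in> set d" "cycle_nbrs c x \<noteq> cycle_nbrs d x"
    using intersecting_cycles_branch[OF cyc(3,4)] by blast
  let ?P = "adj_rel (edges \<Gamma>) (verts \<Gamma> - {x})"
  obtain p q where pq: "p \<noteq> q" "cycle_nbrs c x = {p, q}" "(p, q) \<in> ?P\<^sup>*"
    using cycle_nbrs_obtain[OF G(1) cyc(1) x(1)] by blast
  obtain r s where rs: "r \<noteq> s" "cycle_nbrs d x = {r, s}" "(r, s) \<in> ?P\<^sup>*"
    using cycle_nbrs_obtain[OF G(1) cyc(2) x(2)] by blast
  have "y \<in> nbrs (edges \<Gamma>) (verts \<Gamma>) x" if "{x, y} \<in> edges \<Gamma>" for y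
    using that G(1) by (auto simp: nbrs_def signed_graph_def)
  then have "cycle_nbrs c x \<subseteq> nbrs (edges \<Gamma>) (verts \<Gamma>) x" "cycle_nbrs d x \<subseteq> nbrs (edges \<Gamma>) (verts \<Gamma>) x"
    using cyc(1,2) by (auto simp: cycle_nbrs_def is_cycle_def)
  then have N: "{p, q, r, s} \<subseteq> nbrs (edges \<Gamma>) (verts \<Gamma>) x" using pq(2) rs(2) by simp
  have xV: "x \<in> verts \<Gamma>" using N G(1) by (auto simp: nbrs_def signed_graph_def)
  have sym: "(q, p) \<in> ?P\<^sup>*" "(s, r) \<in> ?P\<^sup>*" using pq(3) rs(3) adj_rel_sym by metis+
  \<comment> \<open>The pairs \<open>{p, q}\<close> and \<open>{r, s}\<close> are distinct
    two-element sets, so one of \<open>p\<close> and \<open>q\<close> lies outside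
    \<open>{r, s}\<close>; it becomes \<open>b1\<close>.\<close>
  obtain a1 b1 where 1: "{a1, b1} = {p, q}" "a1 \<noteq> b1" "b1 \<notin> {r, s}" "(a1, b1) \<in> ?P\<^sup>*"
  proof (cases "q \<in> {r, s}")
    case True
    then have "p \<notin> {r, s}" using pq(1,2) rs(2) x(3) by auto
    then show ?thesis using that[of q p] pq sym by auto
  qed (use that[of p q] pq in auto)
  \<comment> \<open>Choosing \<open>b2\<close> in \<open>{r, s}\<close> different from
    \<open>a1\<close> makes all four distinctness conditions hold, because \<open>b1\<close> is
    outside \<open>{r, s}\<close>.\<close>
  obtain a2 b2 where 2: "{a2, b2} = {r, s}" "a2 \<noteq> b2" "b2 \<noteq> a1" "(a2, b2) \<in> ?P\<^sup>*"
  proof (cases "s = a1")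
    case True
    then show ?thesis using that[of s r] rs sym by auto
  qed (use that[of r s] rs in auto)
  show ?thesis
  proof (rule nested_matching_branch_vertex[where x = x and ?a1.0 = a1 and ?b1.0 = b1 and ?a2.0 = a2 and ?b2.0 = b2])
    have "{a1, b1, a2, b2} = {p, q, r, s}" using 1(1) 2(1) by auto
    then show "{a1, b1, a2, b2} \<subseteq> nbrs (edges \<Gamma>) (verts \<Gamma>) x" using N by simp
  qed (use G xV 1 2 loopless[OF G(1)] conn_verts[OF G] in \<open>auto simp: signed_graph_def\<close>)
qed

section \<open>Negative eigenvalues of symmetric matrices\<close>

text \<open>Over the complex numbers there is an eigenpair \<open>z\<close>, \<open>v\<close>. By
  symmetry the Hermitian form \<open>S\<close> of \<open>v\<close> equals its own conjugate, and it
  is \<open>z\<close> times the positive squared norm \<open>N\<close>, so \<open>z\<close> is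
  real.\<close>

lemma symmetric_eigenvalue_exists:
  fixes A :: "real mat"
  assumes A: "A \<in> carrier_mat n n" and sym: "\<And>i j. i < n \<Longrightarrow> j < n \<Longrightarrow> A $$ (i, j) = A $$ (j, i)"
    and "n > 0"
  shows "\<exists>k. eigenvalue A k"
proof -
  let ?C = "map_mat complex_of_real A"
  have C: "?C \<in> carrier_mat n n" using A by simp
  obtain as where as: "char_poly ?C = (\<Prod>a\<leftarrow>as. [:- a, 1:])" "length as = n"
    using char_poly_factorized[OF C] by blast
  define z where "z = hd as"
  have "z \<in> set as" using as(2) assms(3) unfolding z_def by (cases as) auto
  then have z: "poly (char_poly ?C) z = 0"
    unfolding as(1) poly_prod_list by (force simp: prod_list_zero_iff)
  then obtain v where v: "v \<in> carrier_vec n" "v \<noteq> 0\<^sub>v n" "?C *\<^sub>v v = z \<cdot>\<^sub>v v"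
    using eigenvalue_root_char_poly[OF C] C by (auto simp: eigenvalue_def eigenvector_def)
  define S where "S = (\<Sum>i<n. \<Sum>j<n. cnj (v $ i) * of_real (A $$ (i, j)) * v $ j)"
  define N where "N = (\<Sum>i<n. (cmod (v $ i))\<^sup>2)"
  have row: "(\<Sum>j<n. of_real (A $$ (i, j)) * v $ j) = z * v $ i" if "i < n" for i
  proof -
    have "(\<Sum>j<n. of_real (A $$ (i, j)) * v $ j) = (?C *\<^sub>v v) $ i"
      using that A v(1) by (simp add: scalar_prod_def lessThan_atLeast0)
    then show ?thesis using v(1,3) that by simp
  qed
  have "S = (\<Sum>i<n. cnj (v $ i) * (z * v $ i))"
    unfolding S_def by (rule sum.cong) (simp_all add: row[symmetric] sum_distrib_left mult.assoc)
  also have "\<dots> = z * of_real N"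
    unfolding N_def of_real_sum sum_distrib_left
    by (rule sum.cong) (simp_all add: complex_norm_square mult_ac del: of_real_power)
  finally have SzN: "S = z * of_real N" .
  have "cnj S = (\<Sum>i<n. \<Sum>j<n. cnj (v $ j) * of_real (A $$ (j, i)) * v $ i)"
    unfolding S_def cnj_sum by (intro sum.cong refl) (simp add: sym mult_ac)
  also have "\<dots> = S" unfolding S_def by (rule sum.swap)
  finally have "cnj z * of_real N = z * of_real N" using SzN by simp
  moreover have "N \<noteq> 0"
  proof
    assume "N = 0"
    then have "\<forall>i<n. v $ i = 0" unfolding N_def by (subst (asm) sum_nonneg_eq_0_iff) auto
    then show False using v(1,2) by (auto intro: eq_vecI)
  qed
  ultimately have "cnj z = z" by simp
  then have "z \<in> \<real>" by (simp add: Reals_cnj_iff)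
  then obtain k where k: "z = of_real k" by (auto elim: Reals_cases)
  have "poly (map_poly of_real (char_poly A)) (complex_of_real k) = 0"
    using z unfolding k of_real_hom.char_poly_hom[OF A] .
  then have "poly (char_poly A) k = 0" by simp
  then show ?thesis using eigenvalue_root_char_poly[OF A] by blast
qed

text \<open>The reflection along u - e_0, with u the normalisation of \<open>v\<close> and e_0 the
  first unit vector, sends e_0 to u. Being a symmetric involution, it is an orthogonal change of
  basis that is its own inverse.\<close>

lemma householder:
  fixes v :: "real vec"
  assumes v: "v \<in> carrier_vec n" "v \<noteq> 0\<^sub>v n" and n: "n > 0"
  shows "\<exists>W c. W \<in> carrier_mat n n \<and> W * W = 1\<^sub>m n \<and> W\<^sup>T = W \<and> col W 0 = c \<cdot>\<^sub>v v"
proof -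
  define r where "r = sqrt (\<Sum>i<n. (v $ i)\<^sup>2)"
  have pos: "(\<Sum>i<n. (v $ i)\<^sup>2) > 0"
  proof -
    obtain i where "i < n" "v $ i \<noteq> 0" using v by (metis carrier_vecD eq_vecI index_zero_vec)
    then show ?thesis by (intro sum_pos2[of _ i]) auto
  qed
  then have r: "r > 0" "r\<^sup>2 = (\<Sum>i<n. (v $ i)\<^sup>2)" by (auto simp: r_def)
  define u where "u i = v $ i / r" for i
  define w where "w i = u i - of_bool (i = 0)" for i
  define s where "s = (\<Sum>i<n. w i * w i)"
  have uu: "(\<Sum>i<n. u i * u i) = 1"
    using r pos by (simp add: u_def power2_eq_square[symmetric] power_divide sum_divide_distrib[symmetric])
  have "s = (\<Sum>i<n. u i * u i + (if i = 0 then 1 - 2 * u 0 else 0))"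
    unfolding s_def w_def by (rule sum.cong) (auto simp: algebra_simps)
  then have s: "s = 2 - 2 * u 0" using n uu by (simp add: sum.distrib)
  \<comment> \<open>If u is already e_0, then \<open>s = 0\<close> and division by zero gives 0, so
    \<open>W\<close> is the identity, as desired.\<close>
  define W where "W = mat n n (\<lambda>(i, j). of_bool (i = j) - 2 * w i * w j / s)"
  have W: "W \<in> carrier_mat n n" by (simp add: W_def)
  have "W * W = 1\<^sub>m n"
  proof (rule eq_matI)
    fix i j assume "i < dim_row (1\<^sub>m n :: real mat)" "j < dim_col (1\<^sub>m n :: real mat)"
    then have ij: "i < n" "j < n" by auto
    define c where "c = 4 * w i * w j / s / s"
    have "(W * W) $$ (i, j) =
        (\<Sum>k<n. (of_bool (i = k) - 2 * w i * w k / s) * (of_bool (k = j) - 2 * w k * w j / s))"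
      using ij by (simp add: W_def scalar_prod_def lessThan_atLeast0)
    also have "\<dots> = (\<Sum>k<n. (if k = i then of_bool (i = j) - 2 * w i * w j / s else 0)
        - (if k = j then 2 * w i * w j / s else 0) + c * (w k * w k))"
      by (rule sum.cong) (auto simp: c_def algebra_simps)
    also have "\<dots> = of_bool (i = j) - 4 * w i * w j / s + c * s"
      using ij by (simp add: sum.distrib sum_subtractf sum_distrib_left[symmetric] s_def[symmetric])
    also have "\<dots> = of_bool (i = j)" by (cases "s = 0") (auto simp: c_def)
    finally show "(W * W) $$ (i, j) = 1\<^sub>m n $$ (i, j)" using ij by simp
  qed (use W in auto)
  moreover have "W\<^sup>T = W" by (rule eq_matI) (auto simp: W_def)
  moreover have "col W 0 = (1 / r) \<cdot>\<^sub>v v"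
  proof (rule eq_vecI)
    fix i assume "i < dim_vec ((1 / r) \<cdot>\<^sub>v v)"
    then have i: "i < n" using v by simp
    have "of_bool (i = 0) - 2 * w i * w 0 / s = u i"
    proof (cases "s = 0")
      case True
      then have "w i = 0"
        using i unfolding s_def by (subst (asm) sum_nonneg_eq_0_iff) auto
      then show ?thesis by (auto simp: w_def)
    next
      case False
      \<comment> \<open>The value of \<open>s\<close> is -2 times \<open>w 0\<close>.\<close>
      have "2 * w i * w 0 / s = - w i" using False by (simp add: s w_def field_simps)
      then show ?thesis by (simp add: w_def)
    qed
    then show "col W 0 $ i = ((1 / r) \<cdot>\<^sub>v v) $ i"
      using i n v by (simp add: W_def u_def)
  qed (use v W in auto)
  ultimately show ?thesis using W by blast
qed

text \<open>Let the first column of \<open>W\<close> be a multiple of an eigenvector. The first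
  column of \<open>W * A * W\<close> is then \<open>k\<close> times the first unit vector, and
  symmetry clears the first row as well.\<close>

lemma symmetric_deflation:
  fixes A :: "real mat"
  assumes A: "A \<in> carrier_mat (Suc m) (Suc m)" and sym: "A\<^sup>T = A"
  shows "\<exists>W k B. W \<in> carrier_mat (Suc m) (Suc m) \<and> W * W = 1\<^sub>m (Suc m) \<and> W\<^sup>T = W \<and>
    B \<in> carrier_mat m m \<and> B\<^sup>T = B \<and>
    W * A * W = four_block_mat (mat_diag 1 (\<lambda>_. k)) (0\<^sub>m 1 m) (0\<^sub>m m 1) B"
proof -
  let ?n = "Suc m"
  have symA: "A $$ (i, j) = A $$ (j, i)" if "i < ?n" "j < ?n" for i j
    using arg_cong[OF sym, of "\<lambda>M. M $$ (i, j)"] A that by simp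
  obtain k v where v: "v \<in> carrier_vec ?n" "v \<noteq> 0\<^sub>v ?n" "A *\<^sub>v v = k \<cdot>\<^sub>v v"
    using symmetric_eigenvalue_exists[OF A symA] A by (auto simp: eigenvalue_def eigenvector_def)
  obtain W c where W: "W \<in> carrier_mat ?n ?n" "W * W = 1\<^sub>m ?n" "W\<^sup>T = W" "col W 0 = c \<cdot>\<^sub>v v"
    using householder[OF v(1,2)] by auto
  define M where "M = W * A * W"
  have M: "M \<in> carrier_mat ?n ?n" using W(1) A by (simp add: M_def)
  have MT: "M\<^sup>T = M"
    unfolding M_def using W A sym
    by (simp add: transpose_mult[of _ ?n ?n _ ?n] assoc_mult_mat[of _ ?n ?n _ ?n _ ?n])
  have symM: "M $$ (i, j) = M $$ (j, i)" if "i < ?n" "j < ?n" for i j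
    using arg_cong[OF MT, of "\<lambda>M. M $$ (i, j)"] M that by simp
  have colW: "col W 0 \<in> carrier_vec ?n" using v(1) unfolding W(4) by simp
  have "col M 0 = (W * A) *\<^sub>v col W 0"
    unfolding M_def using W(1) A by (subst col_mult2[of _ ?n ?n _ ?n]) auto
  also have "\<dots> = W *\<^sub>v (A *\<^sub>v col W 0)"
    by (rule assoc_mult_mat_vec[OF W(1) A colW])
  also have "A *\<^sub>v col W 0 = k \<cdot>\<^sub>v col W 0"
    unfolding W(4) using v A by (simp add: mult_mat_vec smult_smult_assoc mult.commute)
  also have "W *\<^sub>v (k \<cdot>\<^sub>v col W 0) = k \<cdot>\<^sub>v (W *\<^sub>v col W 0)"
    by (rule mult_mat_vec[OF W(1) colW])
  also have "W *\<^sub>v col W 0 = col (W * W) 0"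
    using W(1) by (subst col_mult2[of _ ?n ?n _ ?n]) auto
  finally have col0: "col M 0 = k \<cdot>\<^sub>v unit_vec ?n 0" unfolding W(2) by simp
  have M0: "M $$ (i, 0) = (if i = 0 then k else 0)" if "i < ?n" for i
    using arg_cong[OF col0, of "\<lambda>u. u $ i"] that M by (auto simp: unit_vec_def)
  define B where "B = mat m m (\<lambda>(i, j). M $$ (Suc i, Suc j))"
  have "M = four_block_mat (mat_diag 1 (\<lambda>_. k)) (0\<^sub>m 1 m) (0\<^sub>m m 1) B"
  proof (rule eq_matI)
    fix i j
    assume "i < dim_row (four_block_mat (mat_diag 1 (\<lambda>_. k)) (0\<^sub>m 1 m) (0\<^sub>m m 1) B)"
      "j < dim_col (four_block_mat (mat_diag 1 (\<lambda>_. k)) (0\<^sub>m 1 m) (0\<^sub>m m 1) B)"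
    then have ij: "i < ?n" "j < ?n" by (auto simp: mat_diag_def B_def)
    then show "M $$ (i, j) = four_block_mat (mat_diag 1 (\<lambda>_. k)) (0\<^sub>m 1 m) (0\<^sub>m m 1) B $$ (i, j)"
      using M0[of i] M0[of j] symM[of 0 j]
      by (cases i; cases j) (auto simp: mat_diag_def B_def)
  qed (use M in \<open>auto simp: mat_diag_def B_def\<close>)
  moreover have "B\<^sup>T = B" by (rule eq_matI) (auto simp: B_def intro: symM)
  moreover have "B \<in> carrier_mat m m" by (simp add: B_def)
  ultimately show ?thesis using W unfolding M_def by blast
qed

theorem real_spectral_theorem:
  fixes A :: "real mat"
  assumes "A \<in> carrier_mat n n" "A\<^sup>T = A"
  shows "\<exists>P d. P \<in> carrier_mat n n \<and> P\<^sup>T * P = 1\<^sub>m n \<and> A = P * mat_diag n d * P\<^sup>T"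
  using assms
proof (induction n arbitrary: A)
  case 0
  then show ?case by (intro exI[of _ "1\<^sub>m 0"] exI[of _ "\<lambda>_. 0"]) auto
next
  case (Suc m)
  let ?n = "Suc m"
  obtain W k B where W: "W \<in> carrier_mat ?n ?n" "W * W = 1\<^sub>m ?n" "W\<^sup>T = W"
    and B: "B \<in> carrier_mat m m" "B\<^sup>T = B"
    and WAW: "W * A * W = four_block_mat (mat_diag 1 (\<lambda>_. k)) (0\<^sub>m 1 m) (0\<^sub>m m 1) B"
    using symmetric_deflation[OF Suc.prems] by blast
  obtain Q d where Q: "Q \<in> carrier_mat m m" "Q\<^sup>T * Q = 1\<^sub>m m" "B = Q * mat_diag m d * Q\<^sup>T"
    using Suc.IH[OF B] by blast
  let ?F = "\<lambda>X Y. four_block_mat X (0\<^sub>m 1 m) (0\<^sub>m m 1) Y"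
  define R where "R = ?F (1\<^sub>m 1) Q"
  \<comment> \<open>The eigenvalue split off goes to index 0; those of \<open>B\<close> move up by
    one.\<close>
  define e where "e = case_nat k d"
  have "R \<in> carrier_mat (1 + m) (1 + m)"
    unfolding R_def by (rule four_block_carrier_mat) (use Q(1) in auto)
  then have R: "R \<in> carrier_mat ?n ?n" by simp
  have RT: "R\<^sup>T = ?F (1\<^sub>m 1) (Q\<^sup>T)"
    unfolding R_def using Q(1) by (subst transpose_four_block_mat[of _ 1 1 _ m _ m]) auto
  have FF: "?F X Y * ?F X' Y' = ?F (X * X') (Y * Y')"
    if "X \<in> carrier_mat 1 1" "X' \<in> carrier_mat 1 1" "Y \<in> carrier_mat m m" "Y' \<in> carrier_mat m m"
    for X X' Y Y' :: "real mat"
    using that by (subst mult_four_block_mat[of _ 1 1 _ m _ m _ _ 1 _ m]) auto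
  have diag: "mat_diag ?n e = ?F (mat_diag 1 (\<lambda>_. k)) (mat_diag m d)"
    by (rule eq_matI) (auto simp: mat_diag_def e_def split: nat.split)
  have one1: "1\<^sub>m 1 * mat_diag 1 (\<lambda>_. k) * 1\<^sub>m 1 = mat_diag 1 (\<lambda>_. k)"
    by (metis left_mult_one_mat right_mult_one_mat mat_diag_dim)
  have "R * mat_diag ?n e = ?F (1\<^sub>m 1 * mat_diag 1 (\<lambda>_. k)) (Q * mat_diag m d)"
    unfolding diag unfolding R_def by (rule FF) (use Q(1) in auto)
  also have "\<dots> * R\<^sup>T = ?F (1\<^sub>m 1 * mat_diag 1 (\<lambda>_. k) * 1\<^sub>m 1) (Q * mat_diag m d * Q\<^sup>T)"
    unfolding RT by (rule FF) (use Q(1) mult_carrier_mat[OF one_carrier_mat mat_diag_dim] in auto)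
  finally have eqR: "R * mat_diag ?n e * R\<^sup>T = W * A * W"
    unfolding WAW Q(3) one1 .
  have one: "R\<^sup>T * R = 1\<^sub>m ?n"
    unfolding RT unfolding R_def using Q by (subst FF) (auto intro!: eq_matI)
  define P where "P = W * R"
  note assoc = assoc_mult_mat[of _ ?n ?n _ ?n _ ?n]
  have P: "P \<in> carrier_mat ?n ?n" using W(1) R by (simp add: P_def)
  have PT: "P\<^sup>T = R\<^sup>T * W" using W R by (simp add: P_def transpose_mult[of _ ?n ?n _ ?n])
  have "P\<^sup>T * P = R\<^sup>T * (W * W) * R"
    unfolding PT unfolding P_def using W(1) R by (simp add: assoc)
  then have "P\<^sup>T * P = 1\<^sub>m ?n" using W(2) R one by simp
  moreover have "A = P * mat_diag ?n e * P\<^sup>T"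
  proof -
    have "P * mat_diag ?n e * P\<^sup>T = W * (R * mat_diag ?n e * R\<^sup>T) * W"
      unfolding PT unfolding P_def using W(1) R
      by (simp add: assoc mult_carrier_mat[of _ ?n ?n _ ?n])
    also have "\<dots> = (W * W) * A * (W * W)"
      unfolding eqR using W(1) Suc.prems(1) by (simp add: assoc)
    also have "\<dots> = A" using W(2) Suc.prems(1) by simp
    finally show ?thesis by simp
  qed
  ultimately show ?case using P by blast
qed

section \<open>Counting negative eigenvalues by the quadratic form\<close>

text \<open>The order at \<open>x\<close> is the size of the fibre of \<open>d\<close> over
  \<open>x\<close>, and the fibres over negative values partition the negative indices. This turns
  the multiplicity sum of \<open>neg_inertia\<close> into a count of diagonal entries.\<close>

lemma sum_order_prod_linear:
  fixes d :: "'b \<Rightarrow> real"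
  assumes "finite L"
  shows "(\<Sum>x \<in> {x. poly (\<Prod>l\<in>L. [:- d l, 1:]) x = 0 \<and> x < 0}. order x (\<Prod>l\<in>L. [:- d l, 1:]))
    = card {l\<in>L. d l < 0}"
proof -
  have nz: "(\<Prod>l\<in>L. [:- d l, 1:]) \<noteq> 0" if "finite L" for L :: "'b set" using that by simp
  have ord: "order x (\<Prod>l\<in>L. [:- d l, 1:]) = card {l\<in>L. d l = x}" for x
    using assms
  proof (induction L rule: finite_induct)
    case (insert l L)
    have "order x (\<Prod>l\<in>insert l L. [:- d l, 1:]) =
        order x [:- d l, 1:] + order x (\<Prod>l\<in>L. [:- d l, 1:])"
      unfolding prod.insert[OF insert.hyps] 
      by (rule order_mult, rule no_zero_divisors) (use nz[OF insert.hyps(1)] in simp_all)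
    moreover have "{l' \<in> insert l L. d l' = x} =
        (if d l = x then insert l {l\<in>L. d l = x} else {l\<in>L. d l = x})" by auto
    ultimately show ?case
      using insert by (auto simp: order_linear')
  qed simp
  have set: "{x. poly (\<Prod>l\<in>L. [:- d l, 1:]) x = 0 \<and> x < 0} = d ` {l\<in>L. d l < 0}"
    using assms by (auto simp: poly_prod)
  have "(\<Sum>x \<in> d ` {l\<in>L. d l < 0}. card {l\<in>L. d l = x})
      = card (\<Union>x \<in> d ` {l\<in>L. d l < 0}. {l\<in>L. d l = x})"
    using assms by (intro card_UN_disjoint[symmetric]) auto
  also have "(\<Union>x \<in> d ` {l\<in>L. d l < 0}. {l\<in>L. d l = x}) = {l\<in>L. d l < 0}" by auto
  finally show ?thesis unfolding set ord .
qed

definition quad_form :: "'b set \<Rightarrow> ('b \<Rightarrow> 'b \<Rightarrow> real) \<Rightarrow> ('b \<Rightarrow> real) \<Rightarrow> real" where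
  "quad_form V a x = (\<Sum>u\<in>V. \<Sum>v\<in>V. a u v * x u * x v)"

text \<open>States, by means of linear constraints instead of bases, that some \<open>k\<close>-dimensional space of
  functions supported on \<open>S\<close> is negative definite for the form \<open>a\<close>.\<close>

definition neg_dim_ge :: "'b set \<Rightarrow> ('b \<Rightarrow> 'b \<Rightarrow> real) \<Rightarrow> 'b set \<Rightarrow> nat \<Rightarrow> bool" where
  "neg_dim_ge V a S k \<longleftrightarrow> (\<forall>(I :: nat set) p. finite I \<longrightarrow> card I < k \<longrightarrow>
    (\<exists>x. (\<forall>v. v \<notin> S \<longrightarrow> x v = 0) \<and> (\<forall>i\<in>I. (\<Sum>v\<in>V. p i v * x v) = 0) \<and> quad_form V a x < 0))"

text \<open>With fewer than \<open>k\<close> negative diagonal entries, the matching columns of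
  \<open>P\<close> give fewer than \<open>k\<close> constraints. A vector satisfying them has only
  nonnegative squares left in its diagonalised form, which contradicts \<open>neg\<close>.\<close>

lemma negative_eigenvalues_ge:
  fixes A :: "real mat"
  assumes A: "A \<in> carrier_mat n n" "A\<^sup>T = A"
    and neg: "neg_dim_ge {..<n} (\<lambda>i j. A $$ (i, j)) S k"
  shows "k \<le> (\<Sum>x \<in> {x. eigenvalue A x \<and> x < 0}. order x (char_poly A))"
proof -
  obtain P d where P: "P \<in> carrier_mat n n" "P\<^sup>T * P = 1\<^sub>m n" "A = P * mat_diag n d * P\<^sup>T"
    using real_spectral_theorem[OF A] by blast
  define I where "I = {l\<in>{..<n}. d l < 0}"
  have "P * P\<^sup>T = 1\<^sub>m n"
    by (rule mat_mult_left_right_inverse[OF _ P(1,2)]) (use P(1) in simp)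
  then have "similar_mat_wit A (mat_diag n d) P (P\<^sup>T)"
    using P A(1) by (auto simp: similar_mat_wit_def Let_def)
  then have "char_poly A = char_poly (mat_diag n d)"
    by (intro char_poly_similar) (auto simp: similar_mat_def)
  also have "\<dots> = (\<Prod>l\<leftarrow>diag_mat (mat_diag n d). [:- l, 1:])"
    by (rule char_poly_upper_triangular[of _ n]) (auto simp: mat_diag_def)
  also have "diag_mat (mat_diag n d) = map d [0..<n]"
    by (auto simp: diag_mat_def mat_diag_def)
  also have "(\<Prod>l\<leftarrow>map d [0..<n]. [:- l, 1:]) = (\<Prod>l<n. [:- d l, 1:])"
    by (simp add: o_def prod.distinct_set_conv_list[symmetric] lessThan_atLeast0)
  finally have cp: "char_poly A = (\<Prod>l<n. [:- d l, 1:])" .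
  have count: "(\<Sum>x \<in> {x. eigenvalue A x \<and> x < 0}. order x (char_poly A)) = card I"
    unfolding eigenvalue_root_char_poly[OF A(1)] cp I_def by (rule sum_order_prod_linear) simp
  have "\<not> card I < k"
  proof
    assume "card I < k"
    then obtain x where x: "\<forall>l\<in>I. (\<Sum>i<n. P $$ (i, l) * x i) = 0"
      "quad_form {..<n} (\<lambda>i j. A $$ (i, j)) x < 0"
      using neg[unfolded neg_dim_ge_def, rule_format, of I "\<lambda>l i. P $$ (i, l)"]
      by (auto simp: I_def)
    have entry: "A $$ (i, j) = (\<Sum>l<n. P $$ (i, l) * d l * P $$ (j, l))" if "i < n" "j < n" for i j
    proof -
      have "P * mat_diag n d = mat n n (\<lambda>(i, j). P $$ (i, j) * d j)"
        by (rule mat_diag_mult_right[OF P(1)])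
      then show ?thesis
        using that P(1) unfolding P(3) by (simp add: scalar_prod_def lessThan_atLeast0)
    qed
    have "quad_form {..<n} (\<lambda>i j. A $$ (i, j)) x =
        (\<Sum>i<n. \<Sum>j<n. \<Sum>l<n. d l * (P $$ (i, l) * x i) * (P $$ (j, l) * x j))"
      unfolding quad_form_def
      by (intro sum.cong refl) (simp add: entry sum_distrib_left sum_distrib_right mult_ac)
    also have "\<dots> = (\<Sum>l<n. \<Sum>i<n. \<Sum>j<n. d l * (P $$ (i, l) * x i) * (P $$ (j, l) * x j))"
      by (subst (2) sum.swap, subst sum.swap) simp
    also have "\<dots> = (\<Sum>l<n. d l * (\<Sum>i<n. P $$ (i, l) * x i)\<^sup>2)"
      by (simp add: power2_eq_square sum_distrib_left sum_distrib_right mult_ac)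
    also have "\<dots> \<ge> 0"
    proof (rule sum_nonneg)
      fix l assume "l \<in> {..<n}"
      then show "0 \<le> d l * (\<Sum>i<n. P $$ (i, l) * x i)\<^sup>2"
        using x(1) by (cases "l \<in> I") (auto simp: I_def)
    qed
    finally show False using x(2) by simp
  qed
  then show ?thesis unfolding count by simp
qed

section \<open>One negative square for each matching edge\<close>

text \<open>Row \<open>v\<close> of \<open>a\<close> vanishes on the support of \<open>y\<close>, so
  \<beta> enters only through its product with \<alpha>. This leaves \<beta> free to cancel the
  cross term between \<alpha> and \<open>y\<close>.\<close>

lemma quad_form_pair:
  fixes a :: "'b \<Rightarrow> 'b \<Rightarrow> real"
  assumes V: "finite V" "u \<in> V" "v \<in> V" "u \<noteq> v"
    and a: "\<And>i j. a i j = a j i" "a u u = 0" "a v v = 0"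
    and y: "y u = 0" "y v = 0" "\<And>w. y w \<noteq> 0 \<Longrightarrow> a v w = 0"
  shows "quad_form V a (y(u := \<alpha>, v := \<beta>)) =
    quad_form V a y + 2 * \<alpha> * (\<Sum>w\<in>V. a u w * y w) + 2 * \<alpha> * \<beta> * a u v"
proof -
  define x where "x = y(u := \<alpha>, v := \<beta>)"
  define T where "T = V - {u, v}"
  have T: "finite T" "u \<notin> T" "v \<notin> T" "V = insert u (insert v T)" using V by (auto simp: T_def)
  have split: "(\<Sum>w\<in>V. f w) = f u + (f v + (\<Sum>w\<in>T. f w))" for f :: "'b \<Rightarrow> real"
    unfolding T(4) using T(1-3) V(4) by simp
  have x: "x u = \<alpha>" "x v = \<beta>" and xT: "\<And>w. w \<in> T \<Longrightarrow> x w = y w"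
    using V(4) T by (auto simp: x_def)
  have T': "(\<Sum>w\<in>T. f w * x w) = (\<Sum>w\<in>T. f w * y w)" for f
    by (rule sum.cong) (auto simp: xT)
  have row: "(\<Sum>w\<in>V. a p w * x p * x w) = x p * (a p u * \<alpha> + (a p v * \<beta> + (\<Sum>w\<in>T. a p w * y w)))" for p
  proof -
    have "(\<Sum>w\<in>V. a p w * x p * x w) = x p * (\<Sum>w\<in>V. a p w * x w)"
      by (simp add: sum_distrib_left mult_ac)
    then show ?thesis unfolding split[of "\<lambda>w. a p w * x w"] T' x .
  qed
  have row': "(\<Sum>w\<in>V. a p w * y p * y w) = y p * (\<Sum>w\<in>T. a p w * y w)" for p
    using y by (simp add: split sum_distrib_left algebra_simps)
  have v0: "a v w * y w = 0" for w using y(3) by auto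
  have v0': "y w * a w v = 0" for w using v0 a(1) by (metis mult.commute)
  have "quad_form V a x = \<alpha> * (a u v * \<beta> + (\<Sum>w\<in>T. a u w * y w)) + (\<beta> * (a u v * \<alpha>) +
      (\<Sum>p\<in>T. y p * (a p u * \<alpha> + (\<Sum>w\<in>T. a p w * y w))))"
  proof -
    have "(\<Sum>p\<in>T. x p * (a p u * \<alpha> + (a p v * \<beta> + (\<Sum>w\<in>T. a p w * y w)))) =
        (\<Sum>p\<in>T. y p * (a p u * \<alpha> + (\<Sum>w\<in>T. a p w * y w)))"
    proof (rule sum.cong)
      fix p assume "p \<in> T"
      then have "x p = y p" by (rule xT)
      then show "x p * (a p u * \<alpha> + (a p v * \<beta> + (\<Sum>w\<in>T. a p w * y w))) =
          y p * (a p u * \<alpha> + (\<Sum>w\<in>T. a p w * y w))"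
        using v0'[of p] by (simp add: distrib_left mult.assoc[symmetric])
    qed simp
    moreover have "(\<Sum>w\<in>T. a v w * y w) = 0" by (simp add: v0)
    ultimately show ?thesis
      unfolding quad_form_def row split[of "\<lambda>p. x p * _ p"] x
      using a(2,3) a(1)[of v u] by simp
  qed
  moreover have "quad_form V a y = (\<Sum>p\<in>T. y p * (\<Sum>w\<in>T. a p w * y w))"
    unfolding quad_form_def row' by (simp add: split y)
  moreover have "(\<Sum>p\<in>T. y p * (a p u * \<alpha>)) = \<alpha> * (\<Sum>w\<in>T. a u w * y w)"
    unfolding sum_distrib_left by (rule sum.cong) (simp_all add: a(1)[of u])
  moreover have "(\<Sum>w\<in>V. a u w * y w) = (\<Sum>w\<in>T. a u w * y w)"
    by (simp add: split y)
  ultimately show ?thesis unfolding x_def[symmetric] by (simp add: distrib_left sum.distrib algebra_simps)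
qed

text \<open>Vectors on the larger support are parametrised by \<open>y\<close> on \<open>S\<close>
  and a number \<alpha>, with the value at \<open>v\<close> chosen so that the form becomes that of
  \<open>y\<close> minus 2 \<alpha>^2. The new parameter absorbs one more linear constraint.\<close>

lemma neg_dim_ge_pair:
  fixes a :: "'b \<Rightarrow> 'b \<Rightarrow> real"
  assumes V: "finite V" "u \<in> V" "v \<in> V" "u \<noteq> v" and S: "u \<notin> S" "v \<notin> S"
    and a: "\<And>i j. a i j = a j i" "a u u = 0" "a v v = 0" "a u v * a u v = 1"
      "\<And>w. w \<in> S \<Longrightarrow> a v w = 0"
    and neg: "neg_dim_ge V a S k"
  shows "neg_dim_ge V a (insert u (insert v S)) (Suc k)"
  unfolding neg_dim_ge_def
proof (intro allI impI)
  fix I :: "nat set" and p :: "nat \<Rightarrow> 'b \<Rightarrow> real" assume I: "finite I" "card I < Suc k"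
  define s where "s = a u v"
  \<comment> \<open>In the parameters \<open>y\<close> and \<alpha>, constraint \<open>i\<close> has
    coefficient \<open>\<rho> i\<close> at \<alpha> and coefficients \<open>p' i\<close> at
    \<open>y\<close>.\<close>
  define \<rho> where "\<rho> i = p i u - s * p i v" for i
  define p' where "p' i w = p i w - s * p i v * a u w" for i w
  define ext where "ext y \<alpha> = y(u := \<alpha>, v := - s * ((\<Sum>w\<in>V. a u w * y w) + \<alpha>))" for y \<alpha>
  have quad: "quad_form V a (ext y \<alpha>) = quad_form V a y - 2 * \<alpha>\<^sup>2"
    if "\<And>w. w \<notin> S \<Longrightarrow> y w = 0" for y \<alpha>
  proof -
    have z: "y w \<noteq> 0 \<Longrightarrow> a v w = 0" for w using that[of w] a(5)[of w] by blast
    have ss: "s * s = 1" using a(4) by (simp add: s_def)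
    define t where "t = (\<Sum>w\<in>V. a u w * y w)"
    have "quad_form V a (ext y \<alpha>) = quad_form V a y + 2 * \<alpha> * t + 2 * \<alpha> * (- s * (t + \<alpha>)) * s"
      unfolding ext_def t_def s_def
      by (rule quad_form_pair[OF V a(1-3) that[OF S(1)] that[OF S(2)] z])
    also have "2 * \<alpha> * (- s * (t + \<alpha>)) * s = - (2 * \<alpha> * (t + \<alpha>)) * (s * s)"
      by (simp add: algebra_simps)
    finally show ?thesis unfolding ss by (simp add: algebra_simps power2_eq_square)
  qed
  have lin: "(\<Sum>w\<in>V. p i w * ext y \<alpha> w) = \<alpha> * \<rho> i + (\<Sum>w\<in>V. p' i w * y w)"
    if "\<And>w. w \<notin> S \<Longrightarrow> y w = 0" for y \<alpha> i
  proof -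
    define \<beta> where "\<beta> = - s * ((\<Sum>w\<in>V. a u w * y w) + \<alpha>)"
    have "(\<Sum>w\<in>V. p i w * ext y \<alpha> w) =
        (\<Sum>w\<in>V. p i w * y w + ((if w = u then p i u * \<alpha> else 0) + (if w = v then p i v * \<beta> else 0)))"
      by (rule sum.cong) (use that S V(4) in \<open>auto simp: ext_def \<beta>_def\<close>)
    also have "\<dots> = (\<Sum>w\<in>V. p i w * y w) + (p i u * \<alpha> + p i v * \<beta>)"
      using V by (simp add: sum.distrib)
    also have "\<dots> = \<alpha> * \<rho> i + ((\<Sum>w\<in>V. p i w * y w) - s * p i v * (\<Sum>w\<in>V. a u w * y w))"
      by (simp add: \<beta>_def \<rho>_def algebra_simps)
    also have "(\<Sum>w\<in>V. p i w * y w) - s * p i v * (\<Sum>w\<in>V. a u w * y w) = (\<Sum>w\<in>V. p' i w * y w)"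
      by (simp add: p'_def sum_distrib_left sum_subtractf left_diff_distrib mult.assoc)
    finally show ?thesis .
  qed
  have supp: "\<forall>w. w \<notin> insert u (insert v S) \<longrightarrow> ext y \<alpha> w = 0"
    if "\<And>w. w \<notin> S \<Longrightarrow> y w = 0" for y \<alpha>
    using that by (simp add: ext_def)
  show "\<exists>x. (\<forall>w. w \<notin> insert u (insert v S) \<longrightarrow> x w = 0) \<and>
      (\<forall>i\<in>I. (\<Sum>w\<in>V. p i w * x w) = 0) \<and> quad_form V a x < 0"
  proof (cases "\<exists>i\<in>I. \<rho> i \<noteq> 0")
    case False
    \<comment> \<open>No constraint involves \<alpha>, so the pure new direction
      \<open>y = 0\<close>, \<alpha> = 1 solves them all.\<close>
    let ?x = "ext (\<lambda>_. 0) 1"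
    have "quad_form V a ?x < 0" using quad[of "\<lambda>_. 0" 1] by (simp add: quad_form_def)
    moreover have "\<forall>i\<in>I. (\<Sum>w\<in>V. p i w * ?x w) = 0" using lin[of "\<lambda>_. 0" _ 1] False by simp
    ultimately show ?thesis using supp[of "\<lambda>_. 0" 1] by blast
  next
    case True
    then obtain h where h: "h \<in> I" "\<rho> h \<noteq> 0" by blast
    \<comment> \<open>Constraint \<open>h\<close> is the pivot that determines \<alpha>. Eliminating
      \<alpha> from the others leaves fewer than \<open>k\<close> constraints on
      \<open>y\<close>.\<close>
    have "card (I - {h}) < k" using I h card_Suc_Diff1[of I h] by simp
    then obtain y where y: "\<And>w. w \<notin> S \<Longrightarrow> y w = 0" "quad_form V a y < 0"
      "\<forall>i\<in>I - {h}. (\<Sum>w\<in>V. (p' i w - \<rho> i / \<rho> h * p' h w) * y w) = 0"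
      using neg[unfolded neg_dim_ge_def, rule_format, of "I - {h}" "\<lambda>i w. p' i w - \<rho> i / \<rho> h * p' h w"] I(1)
      by auto
    define \<alpha> where "\<alpha> = - (\<Sum>w\<in>V. p' h w * y w) / \<rho> h"
    have lin': "(\<Sum>w\<in>V. p i w * ext y \<alpha> w) = \<alpha> * \<rho> i + (\<Sum>w\<in>V. p' i w * y w)" for i
      by (rule lin) (rule y(1))
    have "(\<Sum>w\<in>V. p i w * ext y \<alpha> w) = 0" if "i \<in> I" for i
    proof (cases "i = h")
      case True
      then show ?thesis using lin' h by (simp add: \<alpha>_def)
    next
      case False
      then have "(\<Sum>w\<in>V. p' i w * y w) = \<rho> i / \<rho> h * (\<Sum>w\<in>V. p' h w * y w)"
        using y(3) that by (simp add: left_diff_distrib sum_subtractf sum_distrib_left mult.assoc)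
      then show ?thesis using lin' by (simp add: \<alpha>_def)
    qed
    moreover have "quad_form V a (ext y \<alpha>) = quad_form V a y - 2 * \<alpha>\<^sup>2"
      by (rule quad) (rule y(1))
    then have "quad_form V a (ext y \<alpha>) < 0" using y(2) zero_le_power2[of \<alpha>] by linarith
    moreover have "\<forall>w. w \<notin> insert u (insert v S) \<longrightarrow> ext y \<alpha> w = 0"
      by (rule supp) (rule y(1))
    ultimately show ?thesis by blast
  qed
qed

lemma neg_dim_ge_mono:
  assumes "neg_dim_ge V a S k" "S \<subseteq> S'"
  shows "neg_dim_ge V a S' k"
  unfolding neg_dim_ge_def
proof (intro allI impI)
  fix I :: "nat set" and p assume "finite I" "card I < k"
  then obtain x where "\<And>v. v \<notin> S \<Longrightarrow> x v = 0" "\<forall>i\<in>I. (\<Sum>v\<in>V. p i v * x v) = 0" "quad_form V a x < 0"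
    using assms(1)[unfolded neg_dim_ge_def, rule_format, of I p] by auto
  then show "\<exists>x. (\<forall>v. v \<notin> S' \<longrightarrow> x v = 0) \<and> (\<forall>i\<in>I. (\<Sum>v\<in>V. p i v * x v) = 0) \<and> quad_form V a x < 0"
    using assms(2) by (intro exI[of _ x]) auto
qed

lemma neg_dim_ge_nested_matching:
  assumes "signed_graph \<Gamma>" "nested_matching (edges \<Gamma>) S k" "S \<subseteq> verts \<Gamma>"
  shows "neg_dim_ge (verts \<Gamma>) (adj_entry \<Gamma>) S k"
  using assms(2,3)
proof induction
  case empty
  then show ?case by (simp add: neg_dim_ge_def)
next
  case (weaken S k S')
  then have "neg_dim_ge (verts \<Gamma>) (adj_entry \<Gamma>) S k" by blast
  then show ?case using neg_dim_ge_mono weaken(2) by blast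
next
  case (pair S k u v)
  have loop: "{x} \<notin> edges \<Gamma>" for x using assms(1) by (auto simp: signed_graph_def)
  show ?case
  proof (rule neg_dim_ge_pair)
    show "neg_dim_ge (verts \<Gamma>) (adj_entry \<Gamma>) S k" using pair by blast
    show "adj_entry \<Gamma> i j = adj_entry \<Gamma> j i" for i j
      by (simp add: adj_entry_def insert_commute)
    show "adj_entry \<Gamma> u v * adj_entry \<Gamma> u v = 1"
      using pair(2) by (simp add: adj_entry_def split: sign.split)
    show "adj_entry \<Gamma> u u = 0" "adj_entry \<Gamma> v v = 0" using loop by (simp_all add: adj_entry_def)
    show "adj_entry \<Gamma> v w = 0" if "w \<in> S" for w using pair(6) that by (simp add: adj_entry_def)
  qed (use pair assms(1) in \<open>auto simp: signed_graph_def\<close>)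
qed

text \<open>Constraints on matrix indices become constraints on vertices through \<open>idx\<close>,
  and a solution on the vertices is carried back by the enumeration \<open>vs\<close>.\<close>

lemma neg_inertia_ge_nested_matching:
  assumes G: "signed_graph \<Gamma>" and nm: "nested_matching (edges \<Gamma>) (verts \<Gamma>) k"
  shows "k \<le> neg_inertia \<Gamma>"
proof -
  define vs where "vs = (SOME vs. distinct vs \<and> set vs = verts \<Gamma>)"
  have "\<exists>vs. distinct vs \<and> set vs = verts \<Gamma>"
    using G finite_distinct_list[of "verts \<Gamma>"] by (auto simp: signed_graph_def)
  then have "distinct vs \<and> set vs = verts \<Gamma>" unfolding vs_def by (rule someI_ex)
  then have vs: "distinct vs" "set vs = verts \<Gamma>" "adj_mat \<Gamma> = adj_mat_enum \<Gamma> vs"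
    by (simp_all add: adj_mat_def vs_def)
  define n where "n = length vs"
  define idx where "idx = inv_into {..<n} ((!) vs)"
  have bij: "bij_betw ((!) vs) {..<n} (verts \<Gamma>)"
    using bij_betw_nth[OF vs(1)] vs(2) by (simp add: n_def)
  have idx: "idx (vs ! i) = i" if "i < n" for i
    unfolding idx_def using bij that by (intro inv_into_f_f) (auto simp: bij_betw_def)
  have A: "adj_mat \<Gamma> \<in> carrier_mat n n" by (simp add: vs(3) adj_mat_enum_def n_def)
  have entry: "adj_mat \<Gamma> $$ (i, j) = adj_entry \<Gamma> (vs ! i) (vs ! j)" if "i < n" "j < n" for i j
    using that by (simp add: vs(3) adj_mat_enum_def n_def)
  have sym: "(adj_mat \<Gamma>)\<^sup>T = adj_mat \<Gamma>"
  proof (rule eq_matI)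
    fix i j assume "i < dim_row (adj_mat \<Gamma>)" "j < dim_col (adj_mat \<Gamma>)"
    then have "i < n" "j < n" using A by auto
    then show "(adj_mat \<Gamma>)\<^sup>T $$ (i, j) = adj_mat \<Gamma> $$ (i, j)"
      using A entry by (simp add: adj_entry_def insert_commute)
  qed (use A in auto)
  have "neg_dim_ge {..<n} (\<lambda>i j. adj_mat \<Gamma> $$ (i, j)) UNIV k"
    unfolding neg_dim_ge_def
  proof (intro allI impI)
    fix I :: "nat set" and p :: "nat \<Rightarrow> nat \<Rightarrow> real"
    assume "finite I" "card I < k"
    then obtain x where x: "\<forall>i\<in>I. (\<Sum>v\<in>verts \<Gamma>. p i (idx v) * x v) = 0"
      "quad_form (verts \<Gamma>) (adj_entry \<Gamma>) x < 0"
      using neg_dim_ge_nested_matching[OF G nm order_refl, unfolded neg_dim_ge_def,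
        rule_format, of I "\<lambda>i v. p i (idx v)"] by blast
    have reindex: "(\<Sum>v\<in>verts \<Gamma>. f v) = (\<Sum>i<n. f (vs ! i))" for f :: "'a \<Rightarrow> real"
      by (rule sum.reindex_bij_betw[OF bij, symmetric])
    have "(\<Sum>j<n. p i j * x (vs ! j)) = 0" if "i \<in> I" for i
      using x(1) that by (simp add: reindex idx)
    moreover have "quad_form {..<n} (\<lambda>i j. adj_mat \<Gamma> $$ (i, j)) (\<lambda>i. x (vs ! i)) < 0"
      using x(2) by (simp add: quad_form_def reindex entry)
    ultimately show "\<exists>x. (\<forall>v. v \<notin> UNIV \<longrightarrow> x v = 0) \<and>
        (\<forall>i\<in>I. (\<Sum>v<n. p i v * x v) = 0) \<and>
        quad_form {..<n} (\<lambda>i j. adj_mat \<Gamma> $$ (i, j)) x < 0"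
      by (intro exI[of _ "\<lambda>i. x (vs ! i)"]) simp
  qed
  then show ?thesis unfolding neg_inertia_def by (rule negative_eigenvalues_ge[OF A sym])
qed

section \<open>The inertia bound\<close>

theorem theorem4p1:
  fixes \<Gamma> :: "'a signed_graph" and n p :: nat
  defines "n \<equiv> graph_order \<Gamma>" and "p \<equiv> num_pendant \<Gamma>"
  assumes "signed_graph \<Gamma>" and "connected_graph \<Gamma>" and "n \<ge> 2"
  shows "real (neg_inertia \<Gamma>) \<ge> (real n - real p) / 2 - real_of_int (cyclomatic \<Gamma>) \<and>
    ((p \<ge> 1 \<or>
      (p = 0 \<and> (\<exists>c d. is_cycle \<Gamma> c \<and> is_cycle \<Gamma> d \<and>
                  cycle_edges c \<noteq> cycle_edges d \<and> set c \<inter> set d \<noteq> {})))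
     \<longrightarrow> real (neg_inertia \<Gamma>) \<ge> (real n - real p + 1) / 2 - real_of_int (cyclomatic \<Gamma>))"
proof -
  let ?E = "edges \<Gamma>" and ?V = "verts \<Gamma>"
  let ?c = "\<Sum>v\<in>?V. charge (deg_in ?E ?V v)"
  have G: "signed_graph \<Gamma>" "connected_graph \<Gamma>" by fact+
  have fV: "finite ?V" using G(1) by (simp add: signed_graph_def)
  have c: "?c = int n - int p - 2 * cyclomatic \<Gamma> + 2"
    unfolding n_def p_def by (rule sum_charge[OF G]) (use \<open>n \<ge> 2\<close> n_def in simp)
  obtain k where k: "nested_matching ?E ?V k" "2 * int k \<ge> ?c - 1 - of_bool (\<not> leafy ?E ?V)"
    using charge_bound_conn[OF fV conn_verts[OF G] loopless[OF G(1)]]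
    by (auto simp: charge_bound_def)
  have kn: "k \<le> neg_inertia \<Gamma>" by (rule neg_inertia_ge_nested_matching[OF G(1) k(1)])
  have strong: "2 * int (neg_inertia \<Gamma>) \<ge> ?c - 1"
    if "p \<ge> 1 \<or> (\<exists>c d. is_cycle \<Gamma> c \<and> is_cycle \<Gamma> d \<and>
      cycle_edges c \<noteq> cycle_edges d \<and> set c \<inter> set d \<noteq> {})"
    using that
  proof
    assume "p \<ge> 1"
    then have "card {v \<in> ?V. vertex_degree \<Gamma> v = 1} \<noteq> 0"
      unfolding p_def num_pendant_def by linarith
    then have "{v \<in> ?V. vertex_degree \<Gamma> v = 1} \<noteq> {}" by (metis card.empty)
    \<comment> \<open>A pendant vertex rules out the extra loss in
      \<open>charge_bound\<close>.\<close>
    then have "leafy ?E ?V" using deg_in_verts[OF G(1)] by force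
    then show ?thesis using k(2) kn by simp
  next
    assume "\<exists>c d. is_cycle \<Gamma> c \<and> is_cycle \<Gamma> d \<and>
      cycle_edges c \<noteq> cycle_edges d \<and> set c \<inter> set d \<noteq> {}"
    then obtain k' where "nested_matching ?E ?V k'" "2 * int k' \<ge> ?c - 1"
      using nested_matching_intersecting_cycles[OF G] by blast
    then show ?thesis using neg_inertia_ge_nested_matching[OF G(1)] by fastforce
  qed
  \<comment> \<open>The summand 2 in \<open>c\<close> absorbs both units that
    \<open>charge_bound\<close> may lose; losing only one leaves the improvement by 1/2.\<close>
  have "2 * int (neg_inertia \<Gamma>) \<ge> int n - int p - 2 * cyclomatic \<Gamma>"
    using k(2) kn c by (simp add: of_bool_def split: if_splits)
  then have "real_of_int (int n - int p - 2 * cyclomatic \<Gamma>) \<le> real_of_int (2 * int (neg_inertia \<Gamma>))"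
    by (simp only: of_int_le_iff)
  then have weak: "real (neg_inertia \<Gamma>) \<ge> (real n - real p) / 2 - real_of_int (cyclomatic \<Gamma>)"
    by (simp add: field_simps)
  have "real (neg_inertia \<Gamma>) \<ge> (real n - real p + 1) / 2 - real_of_int (cyclomatic \<Gamma>)"
    if "2 * int (neg_inertia \<Gamma>) \<ge> ?c - 1"
  proof -
    have "real_of_int (int n - int p - 2 * cyclomatic \<Gamma> + 1) \<le> real_of_int (2 * int (neg_inertia \<Gamma>))"
      using that c by (simp only: of_int_le_iff)
    then show ?thesis by (simp add: field_simps)
  qed
  then show ?thesis using weak strong by blast
qed

end
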